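(* In the supersample setting described in the context, assume the loss takes values in $[0,1]$. Then \[ \left|\mathrm{Err}\right| \leq\frac{1}{n}\sum_{i=1}^n\mathbb{E}_{\widetilde{Z}}\sqrt{2I^{\widetilde{Z}}(\Delta L_i;U_i)}\leq\frac{1}{n}\sum_{i=1}^n\sqrt{2I(\Delta L_i;U_i\mid\widetilde{Z})}. \]
   Context: Let $\mathcal Z=\mathcal X\times\mathcal Y$ and let $\mu$ be a distribution on $\mathcal Z$. A (possibly randomized) learning algorithm $\mathcal A$ maps a training sample in $\mathcal Z^n$ to a hypothesis $W\in\mathcal W$ (it is described by a conditional distribution $P_{W|S}$), and $\ell:\mathcal W\times\mathcal Z\to[0,\infty)$ is a loss. For $S=(Z_1,\dots,Z_n)\sim\mu^{n}$ and $W\sim P_{W|S}$, let $L_\mu=\mathbb E_W\mathbb E_{Z'\sim\mu}[\ell(W,Z')]$ (with $Z'$ independent of $(S,W)$), $L_S(w)=\frac1n\sum_{i=1}^n\ell(w,Z_i)$, $L_n=\mathbb E_{W,S}[L_S(W)]$ and $\mathrm{Err}=L_\mu-L_n$. Supersample: $\widetilde Z=(\widetilde Z_{i,j})_{i\in\{1,\dots,n\},j\in\{0,1\}}$ has i.i.d. entries with law $\mu$; $U=(U_1,\dots,U_n)$ is uniform on $\{0,1\}^n$ and independent of $\widetilde Z$; the training sample is $\widetilde Z_U=(\widetilde Z_{1,U_1},\dots,\widetilde Z_{n,U_n})$ and $W=\mathcal A(\widetilde Z_U)$ (so $(\widetilde Z_U,W)$ has the law of $(S,W)$). Put $L_{i,j}=\ell(W,\widetilde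 Z_{i,j})$, $L_i^+=L_{i,0}$, $L_i^-=L_{i,1}$ and $\Delta L_i=L_i^- - L_i^+$. Mutual information is in nats. For a realization $\tilde z$ of $\widetilde Z$, the disintegrated mutual information is $I^{\tilde z}(X;Y)=D_{\mathrm{KL}}(P_{X,Y|\widetilde Z=\tilde z}\,\|\,P_{X|\widetilde Z=\tilde z}P_{Y|\widetilde Z=\tilde z})$, so $I(X;Y\mid\widetilde Z)=\mathbb E_{\widetilde Z}[I^{\widetilde Z}(X;Y)]$. *)

theory Defs
  imports "HOL-Probability.Probability"
begin

text \<open>Hypothesis indices: samples are functions on {..<n}; supersample entries are
  indexed by (i, j) with j :: bool, where False plays the role of 0 and True of 1.\<close>

definition sample_space :: "nat \<Rightarrow> 'z measure \<Rightarrow> (nat \<Rightarrow> 'z) measure" where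
  "sample_space n \<mu> = PiM {..<n} (\<lambda>_. \<mu>)"

definition supersample_space :: "nat \<Rightarrow> 'z measure \<Rightarrow> (nat \<times> bool \<Rightarrow> 'z) measure" where
  "supersample_space n \<mu> = PiM ({..<n} \<times> UNIV) (\<lambda>_. \<mu>)"

definition U_measure :: "nat \<Rightarrow> (nat \<Rightarrow> bool) measure" where
  "U_measure n = uniform_count_measure (PiE {..<n} (\<lambda>_. UNIV))"

definition select :: "nat \<Rightarrow> (nat \<times> bool \<Rightarrow> 'z) \<Rightarrow> (nat \<Rightarrow> bool) \<Rightarrow> (nat \<Rightarrow> 'z)" where
  "select n zt u = restrict (\<lambda>i. zt (i, u i)) {..<n}"

definition joint_SW :: "nat \<Rightarrow> 'z measure \<Rightarrow> 'w measure \<Rightarrow> ((nat \<Rightarrow> 'z) \<Rightarrow> 'w measure)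
    \<Rightarrow> ((nat \<Rightarrow> 'z) \<times> 'w) measure" where
  "joint_SW n \<mu> Wsp A = sample_space n \<mu> \<bind>
      (\<lambda>s. distr (A s) (sample_space n \<mu> \<Otimes>\<^sub>M Wsp) (\<lambda>w. (s, w)))"

definition pop_risk :: "nat \<Rightarrow> 'z measure \<Rightarrow> 'w measure \<Rightarrow> ((nat \<Rightarrow> 'z) \<Rightarrow> 'w measure)
    \<Rightarrow> ('w \<Rightarrow> 'z \<Rightarrow> real) \<Rightarrow> real" where
  "pop_risk n \<mu> Wsp A loss = (\<integral>sw. (\<integral>z. loss (snd sw) z \<partial>\<mu>) \<partial>joint_SW n \<mu> Wsp A)"

definition emp_risk :: "nat \<Rightarrow> 'z measure \<Rightarrow> 'w measure \<Rightarrow> ((nat \<Rightarrow> 'z) \<Rightarrow> 'w measure)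
    \<Rightarrow> ('w \<Rightarrow> 'z \<Rightarrow> real) \<Rightarrow> real" where
  "emp_risk n \<mu> Wsp A loss =
     (\<integral>sw. (1 / real n) * (\<Sum>i<n. loss (snd sw) (fst sw i)) \<partial>joint_SW n \<mu> Wsp A)"

definition gen_err :: "nat \<Rightarrow> 'z measure \<Rightarrow> 'w measure \<Rightarrow> ((nat \<Rightarrow> 'z) \<Rightarrow> 'w measure)
    \<Rightarrow> ('w \<Rightarrow> 'z \<Rightarrow> real) \<Rightarrow> real" where
  "gen_err n \<mu> Wsp A loss = pop_risk n \<mu> Wsp A loss - emp_risk n \<mu> Wsp A loss"

definition cond_UW :: "nat \<Rightarrow> 'w measure \<Rightarrow> ((nat \<Rightarrow> 'z) \<Rightarrow> 'w measure)
    \<Rightarrow> (nat \<times> bool \<Rightarrow> 'z) \<Rightarrow> ((nat \<Rightarrow> bool) \<times> 'w) measure" where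
  "cond_UW n Wsp A zt = U_measure n \<bind>
      (\<lambda>u. distr (A (select n zt u)) (U_measure n \<Otimes>\<^sub>M Wsp) (\<lambda>w. (u, w)))"

definition DeltaL :: "('w \<Rightarrow> 'z \<Rightarrow> real) \<Rightarrow> (nat \<times> bool \<Rightarrow> 'z) \<Rightarrow> nat
    \<Rightarrow> ((nat \<Rightarrow> bool) \<times> 'w) \<Rightarrow> real" where
  "DeltaL loss zt i uw = loss (snd uw) (zt (i, True)) - loss (snd uw) (zt (i, False))"

definition disint_MI :: "nat \<Rightarrow> 'w measure \<Rightarrow> ((nat \<Rightarrow> 'z) \<Rightarrow> 'w measure)
    \<Rightarrow> ('w \<Rightarrow> 'z \<Rightarrow> real) \<Rightarrow> nat \<Rightarrow> (nat \<times> bool \<Rightarrow> 'z) \<Rightarrow> real" where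
  "disint_MI n Wsp A loss i zt =
     prob_space.mutual_information (cond_UW n Wsp A zt) (exp 1) borel (count_space UNIV)
       (DeltaL loss zt i) (\<lambda>uw. fst uw i)"

definition cond_MI :: "nat \<Rightarrow> 'z measure \<Rightarrow> 'w measure \<Rightarrow> ((nat \<Rightarrow> 'z) \<Rightarrow> 'w measure)
    \<Rightarrow> ('w \<Rightarrow> 'z \<Rightarrow> real) \<Rightarrow> nat \<Rightarrow> real" where
  "cond_MI n \<mu> Wsp A loss i = (\<integral>zt. disint_MI n Wsp A loss i zt \<partial>supersample_space n \<mu>)"

end

theory Submission
  imports Defs
begin

text \<open>
  Write $s = 1$ if $U_i = 0$ and $s = -1$ if $U_i = 1$. Given $U = u$, the training sample together
  with the ghost point $\widetilde Z_{i, 1 - u_i}$ has law $\mu^n \otimes \mu$, so $\mathrm{Err}$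
  is the average over $i$ of $\mathbb E[s\, \Delta L_i]$. For fixed $\widetilde Z$ the joint law of
  $(\Delta L_i, U_i)$ has a density $D \le 2$ with respect to the product law, and
  $y g - e^g + y \le y \ln y$ gives
  $I \ge \mathbb E_{\rm joint}[G] - \mathbb E_{\rm product}[e^G] + 1$ for bounded $G$. With
  $G = E s x - E^2/2$ and $\cosh t \le e^{t^2/2}$ this yields $E^2/2 \le I$ for
  $E = \mathbb E[s\,\Delta L_i]$. The second inequality is concavity of the square root.

  A Bochner integral of a non-measurable function is 0, so the disintegrated mutual information has
  to be measurable everywhere, not just almost everywhere. It is the supremum of the lower bound
  above over a countable family of $G$ that does not depend on $\widetilde Z$.
\<close>

section \<open>Approximation by rational step functions\<close>

text \<open>The density of the joint law comes from a Radon-Nikodym theorem that is applied at each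
  supersample separately, so it offers no measurable dependence on the supersample. The hypothesis
  space is an arbitrary measurable space; the way out is to work with the law of
  \<open>(X, Y)\<close> on pairs of a real and a bit. There the half-lines with rational endpoints
  generate the Borel sets, and rational step functions are L1-dense for every finite Borel measure
  on the line, hence for all the laws that arise at once. The bound 2 on the density is the
  reciprocal of the probability 1/2 of each bit value: the law of \<open>X\<close> given
  \<open>Y\<close> is dominated by twice the law of \<open>X\<close>. It keeps \<open>y ln y\<close>
  bounded, so the information is at most \<open>ln 2\<close> and integrability reduces to constant
  bounds throughout. The test function is the tilt \<open>t s x - t^2 / 2\<close> at the maximiser
  \<open>t = E\<close> of \<open>t E - t^2 / 2\<close>. Under the product law the sign is fair and
  independent of \<open>x\<close>, so its exponential moment is at most 1 when
  \<open>\<bar>x\<bar> \<le> 1\<close>.\<close>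

definition step_fun :: "(rat \<times> rat) list \<Rightarrow> real \<Rightarrow> real" where
  "step_fun cs x = (\<Sum>(q, r)\<leftarrow>cs. of_rat q * indicator {..of_rat r} x)"

lemma step_fun_Nil [simp]: "step_fun [] x = 0"
  by (simp add: step_fun_def)

lemma step_fun_Cons [simp]:
  "step_fun ((q, r) # cs) x = of_rat q * indicator {..of_rat r} x + step_fun cs x"
  by (simp add: step_fun_def)

lemma step_fun_append: "step_fun (cs @ ds) x = step_fun cs x + step_fun ds x"
  by (simp add: step_fun_def)

lemma step_fun_scale: "step_fun (map (\<lambda>(q, r). (c * q, r)) cs) x = of_rat c * step_fun cs x"
  by (induction cs) (auto simp: of_rat_mult algebra_simps)

lemma measurable_step_fun [measurable]: "step_fun cs \<in> borel_measurable borel"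
  by (induction cs) (auto simp: cong: measurable_cong)

lemma step_fun_bounded: "\<exists>B. \<forall>x. \<bar>step_fun cs x\<bar> \<le> B"
proof (induction cs)
  case (Cons c cs)
  then obtain B where B: "\<And>x. \<bar>step_fun cs x\<bar> \<le> B" by blast
  have "\<bar>step_fun (c # cs) x\<bar> \<le> \<bar>of_rat (fst c)\<bar> + B" for x
    using B[of x] by (cases c) (auto simp: indicator_def simp del: abs_of_rat)
  then show ?case by blast
qed auto

text \<open>Membership in the L1 closure of the step functions. A Bochner integral that diverges is
  0, so the predicate is informative only for integrable \<open>f\<close>; the lemmas below carry
  integrability along separately. The lists of rational pairs in \<open>step_fun\<close> keep the
  approximating class countable.\<close>

definition step_approx :: "real measure \<Rightarrow> (real \<Rightarrow> real) \<Rightarrow> bool" where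
  "step_approx M f \<longleftrightarrow> (\<forall>e>0. \<exists>cs. (\<integral>x. \<bar>f x - step_fun cs x\<bar> \<partial>M) < e)"

lemma integral_abs_diff_triangle:
  fixes f g h :: "'a \<Rightarrow> real"
  assumes "integrable M f" "integrable M g" "integrable M h"
  shows "(\<integral>x. \<bar>f x - h x\<bar> \<partial>M) \<le> (\<integral>x. \<bar>f x - g x\<bar> \<partial>M) + (\<integral>x. \<bar>g x - h x\<bar> \<partial>M)"
proof -
  have "(\<integral>x. \<bar>f x - h x\<bar> \<partial>M) \<le> (\<integral>x. \<bar>f x - g x\<bar> + \<bar>g x - h x\<bar> \<partial>M)"
    using assms by (intro integral_mono) auto
  then show ?thesis using assms by simp
qed

context
  fixes M :: "real measure"
  assumes fin: "finite_measure M" and sets_M [measurable_cong]: "sets M = sets borel"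
begin

interpretation finite_measure M by (fact fin)

lemma integrable_step_fun: "integrable M (step_fun cs)"
proof -
  obtain B where "\<And>x. \<bar>step_fun cs x\<bar> \<le> B" using step_fun_bounded by blast
  then show ?thesis by (intro integrable_const_bound[where B=B]) auto
qed

lemma step_approx_step_fun: "step_approx M (step_fun cs)"
  unfolding step_approx_def by (auto intro!: exI[of _ cs])

text \<open>The L1 closure is itself closed: half of the tolerance goes to the passage from
  \<open>f\<close> to \<open>g\<close>, half to that from \<open>g\<close> to a step
  function.\<close>

lemma step_approx_close:
  assumes f: "integrable M f"
    and close: "\<And>e. e > 0 \<Longrightarrow> \<exists>g. integrable M g \<and> step_approx M g \<and> (\<integral>x. \<bar>f x - g x\<bar> \<partial>M) < e"
  shows "step_approx M f"
  unfolding step_approx_def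
proof (intro allI impI)
  fix e :: real assume "e > 0"
  then obtain g where g: "integrable M g" "step_approx M g" "(\<integral>x. \<bar>f x - g x\<bar> \<partial>M) < e / 2"
    using close[of "e / 2"] by auto
  obtain cs where cs: "(\<integral>x. \<bar>g x - step_fun cs x\<bar> \<partial>M) < e / 2"
    using g(2) \<open>e > 0\<close> by (auto simp: step_approx_def dest: spec[of _ "e / 2"])
  show "\<exists>cs. (\<integral>x. \<bar>f x - step_fun cs x\<bar> \<partial>M) < e"
    using integral_abs_diff_triangle[OF f g(1) integrable_step_fun[of cs]] g(3) cs
    by (intro exI[of _ cs]) linarith
qed

text \<open>Dominated convergence: pointwise limits under an integrable majorant are limits in
  L1.\<close>

lemma step_approx_lim:
  assumes s: "\<And>i. integrable M (s i)" "\<And>i::nat. step_approx M (s i)"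
    and lim: "\<And>x. (\<lambda>i. s i x) \<longlonglongrightarrow> f x"
    and bound: "\<And>i x. \<bar>s i x\<bar> \<le> w x" and w: "integrable M w"
  shows "step_approx M f"
proof -
  have [measurable]: "\<And>i. s i \<in> borel_measurable M" using s(1) by auto
  have meas [measurable]: "f \<in> borel_measurable M"
    by (rule borel_measurable_LIMSEQ_metric[of s]) (auto intro: lim)
  have fw: "\<bar>f x\<bar> \<le> w x" for x
    by (rule LIMSEQ_le_const2[OF tendsto_rabs[OF lim]]) (use bound in auto)
  have f: "integrable M f"
    using w by (rule Bochner_Integration.integrable_bound)
      (auto intro!: AE_I2 order_trans[OF fw])
  have "(\<lambda>i. \<integral>x. \<bar>f x - s i x\<bar> \<partial>M) \<longlonglongrightarrow> (\<integral>x. 0 \<partial>M)"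
  proof (rule integral_dominated_convergence[where w="\<lambda>x. 2 * w x"])
    show "AE x in M. (\<lambda>i. \<bar>f x - s i x\<bar>) \<longlonglongrightarrow> 0"
    proof (rule AE_I2)
      fix x show "(\<lambda>i. \<bar>f x - s i x\<bar>) \<longlonglongrightarrow> 0"
        using tendsto_rabs[OF tendsto_diff[OF tendsto_const lim[of x], of "f x"]] by simp
    qed
    show "AE x in M. norm \<bar>f x - s i x\<bar> \<le> 2 * w x" for i
    proof (rule AE_I2)
      fix x show "norm \<bar>f x - s i x\<bar> \<le> 2 * w x"
        using fw[of x] bound[of i x] by simp
    qed
  qed (use w in auto)
  then have *: "(\<lambda>i. \<integral>x. \<bar>f x - s i x\<bar> \<partial>M) \<longlonglongrightarrow> 0" by simp
  show ?thesis
  proof (rule step_approx_close[OF f])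
    fix e :: real assume "e > 0"
    then obtain i where "(\<integral>x. \<bar>f x - s i x\<bar> \<partial>M) < e"
      using order_tendstoD(2)[OF *, of e] by (auto simp: eventually_sequentially)
    then show "\<exists>g. integrable M g \<and> step_approx M g \<and> (\<integral>x. \<bar>f x - g x\<bar> \<partial>M) < e"
      using s by blast
  qed
qed

lemma step_approx_add:
  assumes f: "integrable M f" "step_approx M f" and g: "integrable M g" "step_approx M g"
  shows "step_approx M (\<lambda>x. f x + g x)"
  unfolding step_approx_def
proof (intro allI impI)
  fix e :: real assume "e > 0"
  then obtain cs ds where
    cs: "(\<integral>x. \<bar>f x - step_fun cs x\<bar> \<partial>M) < e / 2" and ds: "(\<integral>x. \<bar>g x - step_fun ds x\<bar> \<partial>M) < e / 2"
    using f(2) g(2) unfolding step_approx_def by (metis half_gt_zero)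
  have "(\<integral>x. \<bar>f x + g x - step_fun (cs @ ds) x\<bar> \<partial>M)
      \<le> (\<integral>x. \<bar>f x - step_fun cs x\<bar> + \<bar>g x - step_fun ds x\<bar> \<partial>M)"
    using f(1) g(1) integrable_step_fun
    by (intro integral_mono) (auto simp: step_fun_append)
  also have "\<dots> = (\<integral>x. \<bar>f x - step_fun cs x\<bar> \<partial>M) + (\<integral>x. \<bar>g x - step_fun ds x\<bar> \<partial>M)"
    using f(1) g(1) integrable_step_fun by simp
  finally show "\<exists>cs. (\<integral>x. \<bar>f x + g x - step_fun cs x\<bar> \<partial>M) < e"
    using cs ds by (intro exI[of _ "cs @ ds"]) linarith
qed

lemma step_approx_rat_scale:
  assumes f: "integrable M f" "step_approx M f"
  shows "step_approx M (\<lambda>x. of_rat c * f x)"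
  unfolding step_approx_def
proof (intro allI impI)
  fix e :: real assume e: "e > 0"
  define C where "C = \<bar>of_rat c :: real\<bar>"
  have C: "C \<ge> 0" by (simp add: C_def)
  \<comment> \<open>The added 1 keeps \<open>d\<close> positive when \<open>c = 0\<close> and makes
    \<open>C * d < e\<close> strict.\<close>
  define d where "d = e / (C + 1)"
  have d: "d > 0" "C * d < e"
    using e C by (auto simp: d_def field_simps intro: add_nonneg_pos)
  then obtain cs where cs: "(\<integral>x. \<bar>f x - step_fun cs x\<bar> \<partial>M) < d"
    using f(2) by (auto simp: step_approx_def)
  let ?cs = "map (\<lambda>(q, r). (c * q, r)) cs"
  have "(\<integral>x. \<bar>of_rat c * f x - step_fun ?cs x\<bar> \<partial>M) = (\<integral>x. C * \<bar>f x - step_fun cs x\<bar> \<partial>M)"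
    by (simp add: step_fun_scale C_def abs_mult[symmetric] right_diff_distrib del: abs_of_rat)
  also have "\<dots> = C * (\<integral>x. \<bar>f x - step_fun cs x\<bar> \<partial>M)" by simp
  also have "\<dots> \<le> C * d" using cs C by (intro mult_left_mono) auto
  finally show "\<exists>cs. (\<integral>x. \<bar>of_rat c * f x - step_fun cs x\<bar> \<partial>M) < e"
    using d(2) by (intro exI[of _ ?cs]) linarith
qed

text \<open>Coefficients of step functions are rational, so a real factor is replaced by a nearby
  rational one; the L1 error is the distance of the factors times the norm of
  \<open>f\<close>.\<close>

lemma step_approx_scale:
  assumes f: "integrable M f" "step_approx M f"
  shows "step_approx M (\<lambda>x. c * f x)"
proof (rule step_approx_close)
  fix e :: real assume e: "e > 0"
  define I where "I = (\<integral>x. \<bar>f x\<bar> \<partial>M)"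
  have I: "I \<ge> 0" by (simp add: I_def)
  obtain q where q: "c < of_rat q" "of_rat q < c + e / (I + 1)"
    using of_rat_dense[of c "c + e / (I + 1)"] e I by (auto simp: add_nonneg_pos)
  have "(\<integral>x. \<bar>c * f x - of_rat q * f x\<bar> \<partial>M) = \<bar>c - of_rat q\<bar> * I"
    by (simp add: I_def abs_mult[symmetric] left_diff_distrib flip: integral_mult_right_zero)
  also have "\<dots> \<le> e / (I + 1) * I" using q I by (intro mult_right_mono) auto
  also have "\<dots> < e" using e I by (simp add: field_simps)
  finally show "\<exists>g. integrable M g \<and> step_approx M g \<and> (\<integral>x. \<bar>c * f x - g x\<bar> \<partial>M) < e"
    using f step_approx_rat_scale[OF f] by (intro exI[of _ "\<lambda>x. of_rat q * f x"]) auto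
qed (use f in auto)

text \<open>The endpoint \<open>a\<close> may be irrational. Rational endpoints approach it strictly
  from above, so that all the half-lines contain \<open>a\<close> itself and converge pointwise to
  the closed half-line.\<close>

lemma step_approx_atMost: "step_approx M (indicator {..a})"
proof -
  have "\<exists>q. a < of_rat q \<and> of_rat q < a + 1 / real (Suc n)" for n
    using of_rat_dense[of a "a + 1 / real (Suc n)"] by auto
  then obtain q where q: "\<And>n. a < of_rat (q n)" "\<And>n. of_rat (q n) < a + 1 / real (Suc n)"
    by metis
  have eq: "step_fun [(1, q n)] = indicator {..of_rat (q n)}" for n
    by (auto simp: fun_eq_iff)
  have lim: "(\<lambda>n. step_fun [(1, q n)] x) \<longlonglongrightarrow> indicator {..a} x" for x
  proof (cases "x \<le> a")
    case True
    then have "x \<le> of_rat (q n)" for n using q(1)[of n] by linarith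
    then show ?thesis using True by (simp add: eq indicator_def)
  next
    case False
    then have "\<forall>\<^sub>F n in sequentially. 1 / real (Suc n) < x - a"
      using LIMSEQ_Suc[OF lim_1_over_n] by (intro order_tendstoD(2)) auto
    then have "\<forall>\<^sub>F n in sequentially. step_fun [(1, q n)] x = 0"
    proof eventually_elim
      case (elim n)
      then have "of_rat (q n) < x" using q(2)[of n] by linarith
      then show ?case by simp
    qed
    then show ?thesis using False by (simp add: tendsto_eventually)
  qed
  show ?thesis
    by (rule step_approx_lim[OF integrable_step_fun step_approx_step_fun lim, where w="\<lambda>_. 1"])
      (auto simp: eq indicator_def)
qed

lemma step_approx_one: "step_approx M (\<lambda>x. 1)"
proof (rule step_approx_lim[where s="\<lambda>n. indicator {..real n}" and w="\<lambda>_. 1"])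
  show "(\<lambda>n. indicator {..real n} x) \<longlonglongrightarrow> (1::real)" for x :: real
  proof (rule tendsto_eventually)
    obtain n where "x \<le> real n" using real_arch_simple by blast
    then show "\<forall>\<^sub>F n in sequentially. indicator {..real n} x = (1::real)"
      by (auto simp: eventually_sequentially indicator_def intro!: exI[of _ n])
  qed
  show "integrable M (indicator {..real n} :: real \<Rightarrow> real)" for n
    by (intro integrable_const_bound[where B=1]) auto
qed (auto simp: step_approx_atMost indicator_def)

text \<open>Dynkin's argument: half-lines are an intersection-stable generator of the Borel sets,
  and the sets with approximable indicator are closed under complements and countable disjoint
  unions, the latter as dominated limits of finite sums.\<close>

lemma step_approx_indicator:
  assumes "A \<in> sets borel"
  shows "step_approx M (indicator A)"
proof -
  have [simp]: "sigma_sets UNIV (range (\<lambda>a. {..a::real})) = sets borel"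
    by (subst borel_eq_atMost) simp
  have int: "integrable M (indicator A :: real \<Rightarrow> real)" if "A \<in> sets borel" for A
    using that by (intro integrable_const_bound[where B=1]) auto
  have "Int_stable (range (\<lambda>a. {..a::real}))"
    by (auto simp: Int_stable_def)
  moreover have "range (\<lambda>a. {..a::real}) \<subseteq> Pow UNIV" by simp
  moreover have "A \<in> sigma_sets UNIV (range (\<lambda>a. {..a::real}))"
    using assms by simp
  ultimately show ?thesis
  proof (induction rule: sigma_sets_induct_disjoint)
    case (basic A)
    then show ?case by (auto simp: step_approx_atMost)
  next
    case empty
    show ?case using step_approx_step_fun[of "[]"] by (simp add: step_approx_def)
  next
    case (compl A)
    then have A: "A \<in> sets borel" by simp
    have "step_approx M (\<lambda>x. 1 + (- 1) * indicator A x)"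
      using compl int[OF A] by (intro step_approx_add step_approx_one step_approx_scale) auto
    also have "(\<lambda>x. 1 + (- 1) * indicator A x) = (indicator (UNIV - A) :: real \<Rightarrow> real)"
      by (auto simp: indicator_def fun_eq_iff)
    finally show ?case .
  next
    case (union A)
    then have A: "A i \<in> sets borel" for i by auto
    have *: "(\<Sum>i<n. indicator (A i) x) = (indicator (\<Union>i<n. A i) x :: real)" for n :: nat and x
      using union(1) by (intro indicator_UN_disjoint[symmetric])
        (auto intro: disjoint_family_on_mono)
    have s: "step_approx M (\<lambda>x. \<Sum>i<n. indicator (A i) x)" for n :: nat
    proof (induction n)
      case 0 show ?case using step_approx_step_fun[of "[]"] by (simp add: step_approx_def)
    next
      case (Suc n) then show ?case
        using int[OF A] union by (auto intro!: step_approx_add)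
    qed
    show ?case
    proof (rule step_approx_lim[where s="\<lambda>n x. \<Sum>i<n. indicator (A i) x" and w="\<lambda>_. 1"])
      show "(\<lambda>n. \<Sum>i<n. indicator (A i) x) \<longlonglongrightarrow> (indicator (\<Union>i. A i) x :: real)" for x
        unfolding * by (rule LIMSEQ_indicator_UN)
      show "\<bar>\<Sum>i<n. indicator (A i) x\<bar> \<le> (1::real)" for n x
        unfolding * by (simp add: indicator_def)
    qed (use s int[OF A] in auto)
  qed
qed

lemma step_approx_integrable:
  assumes "integrable M f"
  shows "step_approx M f"
  using assms
proof induction
  case (base A c)
  then have "step_approx M (\<lambda>x. c * indicator A x)"
    by (intro step_approx_scale step_approx_indicator) (auto simp: sets_M)
  then show ?case by (simp add: mult.commute)
next
  case (add f g)
  then show ?case by (intro step_approx_add)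
next
  case (lim f s)
  \<comment> \<open>The induction yields convergence and domination on \<open>space M\<close>;
    \<open>step_approx_lim\<close> asks for them at every real.\<close>
  have [simp]: "space M = UNIV" using sets_eq_imp_space_eq[OF sets_M] by simp
  show ?case
    by (rule step_approx_lim[where s=s and w="\<lambda>x. 2 * \<bar>f x\<bar>"]) (use lim in auto)
qed

end

section \<open>Joint law of a real variable and a fair bit\<close>

text \<open>Abstracts the situation at a fixed supersample: \<open>M\<close> is the conditional law
  of bits and hypothesis, \<open>X\<close> the loss difference, \<open>Y\<close> the bit
  \<open>U_i\<close>. Fairness of \<open>Y\<close> is the source of the bound 2 on the
  density.\<close>

locale fair_bit_pair = prob_space M for M :: "'a measure" +
  fixes X :: "'a \<Rightarrow> real" and Y :: "'a \<Rightarrow> bool"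
  assumes X [measurable]: "X \<in> borel_measurable M"
    and Y [measurable]: "Y \<in> M \<rightarrow>\<^sub>M count_space UNIV"
    and fair: "prob {\<omega> \<in> space M. Y \<omega>} = 1 / 2"
begin

definition joint :: "(real \<times> bool) measure" where
  "joint = distr M (borel \<Otimes>\<^sub>M count_space UNIV) (\<lambda>\<omega>. (X \<omega>, Y \<omega>))"

definition indep :: "(real \<times> bool) measure" where
  "indep = distr M borel X \<Otimes>\<^sub>M distr M (count_space UNIV) Y"

definition mi :: real where
  "mi = mutual_information (exp 1) borel (count_space UNIV) X Y"

text \<open>The variational lower bound, with the integral over the product law resolved into the
  average over the two values of the bit. Both terms are thus plain integrals against
  \<open>M\<close>, whose dependence on the supersample can be controlled; neither
  \<open>indep\<close> nor a density occurs.\<close>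

definition dual_value :: "(real \<times> bool \<Rightarrow> real) \<Rightarrow> real" where
  "dual_value G = expectation (\<lambda>\<omega>. G (X \<omega>, Y \<omega>))
     - expectation (\<lambda>\<omega>. (exp (G (X \<omega>, True)) + exp (G (X \<omega>, False))) / 2) + 1"

lemma sets_joint [measurable_cong]: "sets joint = sets (borel \<Otimes>\<^sub>M count_space UNIV)"
  by (simp add: joint_def)

lemma sets_indep [measurable_cong]: "sets indep = sets (borel \<Otimes>\<^sub>M count_space UNIV)"
  unfolding indep_def by (intro sets_pair_measure_cong) auto

lemma space_indep: "space indep = UNIV"
  by (simp add: indep_def space_pair_measure)

lemma prob_space_joint: "prob_space joint"
  unfolding joint_def by (intro prob_space_distr) measurable

lemma prob_space_indep: "prob_space indep"
  unfolding indep_def by (intro prob_space_pair prob_space_distr) auto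

sublocale J: prob_space joint by (rule prob_space_joint)
sublocale P: prob_space indep by (rule prob_space_indep)

lemma integral_joint:
  fixes G :: "real \<times> bool \<Rightarrow> real"
  assumes [measurable]: "G \<in> borel_measurable (borel \<Otimes>\<^sub>M count_space UNIV)"
  shows "(\<integral>z. G z \<partial>joint) = expectation (\<lambda>\<omega>. G (X \<omega>, Y \<omega>))"
  unfolding joint_def by (subst integral_distr) auto

lemma expectation_fair:
  fixes g :: "bool \<Rightarrow> real"
  shows "expectation (\<lambda>\<omega>. g (Y \<omega>)) = (g True + g False) / 2"
proof -
  have [measurable]: "{\<omega> \<in> space M. Y \<omega>} \<in> events" by measurable
  have "expectation (\<lambda>\<omega>. g (Y \<omega>))
      = expectation (\<lambda>\<omega>. g False + (g True - g False) * indicator {\<omega> \<in> space M. Y \<omega>} \<omega>)"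
    by (intro Bochner_Integration.integral_cong) (auto simp: indicator_def)
  also have "\<dots> = g False + (g True - g False) * prob {\<omega> \<in> space M. Y \<omega>}"
    by (subst Bochner_Integration.integral_add) (auto simp: prob_space emeasure_eq_measure)
  finally show ?thesis by (simp add: fair field_simps)
qed

lemma integral_indep:
  fixes G :: "real \<times> bool \<Rightarrow> real"
  assumes [measurable]: "G \<in> borel_measurable (borel \<Otimes>\<^sub>M count_space UNIV)"
    and int: "integrable indep G"
  shows "(\<integral>z. G z \<partial>indep) = expectation (\<lambda>\<omega>. (G (X \<omega>, True) + G (X \<omega>, False)) / 2)"
proof -
  interpret X: prob_space "distr M borel X" by (rule prob_space_distr) simp
  interpret Y: prob_space "distr M (count_space UNIV) Y" by (rule prob_space_distr) simp
  interpret pair_sigma_finite "distr M borel X" "distr M (count_space UNIV) Y" ..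
  have "(\<integral>z. G z \<partial>indep)
      = (\<integral>x. (\<integral>y. G (x, y) \<partial>distr M (count_space UNIV) Y) \<partial>distr M borel X)"
    using int unfolding indep_def by (simp add: integral_fst')
  also have "\<dots> = (\<integral>x. (G (x, True) + G (x, False)) / 2 \<partial>distr M borel X)"
    by (intro Bochner_Integration.integral_cong refl, subst integral_distr)
      (auto simp: expectation_fair[of "\<lambda>b. G (x, b)" for x])
  also have "\<dots> = expectation (\<lambda>\<omega>. (G (X \<omega>, True) + G (X \<omega>, False)) / 2)"
    by (subst integral_distr) auto
  finally show ?thesis .
qed

lemma integrable_indep:
  fixes G :: "real \<times> bool \<Rightarrow> real"
  assumes "G \<in> borel_measurable (borel \<Otimes>\<^sub>M count_space UNIV)" "\<And>z. \<bar>G z\<bar> \<le> B"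
  shows "integrable indep G"
  using assms by (intro P.integrable_const_bound[where B=B]) auto

text \<open>Pointwise, the indicator at the actual bit is at most the sum of the indicators at both
  bit values, and this sum is twice their fair average.\<close>

lemma joint_le_indep:
  assumes A [measurable]: "A \<in> sets (borel \<Otimes>\<^sub>M count_space UNIV)"
  shows "J.prob A \<le> 2 * P.prob A"
proof -
  have "J.prob A = (\<integral>z. indicator A z \<partial>joint)"
    using A by (simp add: sets_joint)
  also have "\<dots> = expectation (\<lambda>\<omega>. indicator A (X \<omega>, Y \<omega>))"
    by (rule integral_joint) measurable
  also have "\<dots> \<le> expectation (\<lambda>\<omega>. 2 * ((indicator A (X \<omega>, True) + indicator A (X \<omega>, False)) / 2 :: real))"
  proof (rule integral_mono)
    show "integrable M (\<lambda>\<omega>. indicator A (X \<omega>, Y \<omega>) :: real)"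
      by (intro integrable_const_bound[where B=1]) (auto simp: indicator_def)
    show "integrable M (\<lambda>\<omega>. 2 * ((indicator A (X \<omega>, True) + indicator A (X \<omega>, False)) / 2 :: real))"
      by (intro integrable_const_bound[where B=2]) (auto simp: indicator_def)
    show "(indicator A (X \<omega>, Y \<omega>) :: real)
        \<le> 2 * ((indicator A (X \<omega>, True) + indicator A (X \<omega>, False)) / 2)" for \<omega>
      by (cases "Y \<omega>") (auto simp: indicator_def)
  qed
  also have "\<dots> = 2 * expectation (\<lambda>\<omega>. (indicator A (X \<omega>, True) + indicator A (X \<omega>, False)) / 2 :: real)"
    by (rule integral_mult_right_zero)
  also have "expectation (\<lambda>\<omega>. (indicator A (X \<omega>, True) + indicator A (X \<omega>, False)) / 2 :: real)
      = (\<integral>z. indicator A z \<partial>indep)"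
  proof (rule integral_indep[where G="indicator A", symmetric])
    show "integrable indep (indicator A :: real \<times> bool \<Rightarrow> real)"
      by (rule integrable_indep[where B=1]) (auto simp: indicator_def)
  qed measurable
  also have "(\<integral>z. indicator A z \<partial>indep) = P.prob A"
    using A by (simp add: sets_indep)
  finally show ?thesis .
qed

text \<open>By \<open>joint_le_indep\<close> the joint law is absolutely continuous and its density
  exceeds 2 only on a null set. Truncation at 2 gives a version that is bounded everywhere.\<close>

lemma joint_density:
  obtains D where "D \<in> borel_measurable (borel \<Otimes>\<^sub>M count_space UNIV)"
    "\<And>z. 0 \<le> D z" "\<And>z. D z \<le> 2" "joint = density indep (\<lambda>z. ennreal (D z))"
proof -
  have ac: "absolutely_continuous indep joint"
  proof (unfold absolutely_continuous_def, rule subsetI)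
    fix A assume A: "A \<in> null_sets indep"
    then have A': "A \<in> sets (borel \<Otimes>\<^sub>M count_space UNIV)" by (auto simp: sets_indep)
    have "P.prob A = 0" using A by (simp add: null_sets_def measure_def)
    then have "J.prob A = 0" using joint_le_indep[OF A'] by (simp add: measure_le_0_iff)
    then show "A \<in> null_sets joint"
      using A' by (simp add: null_sets_def J.emeasure_eq_measure sets_joint)
  qed
  have sets: "sets joint = sets indep" by (simp add: sets_joint sets_indep)
  obtain D where D [measurable]: "D \<in> borel_measurable indep"
    and D_RN: "AE z in indep. RN_deriv indep joint z = ennreal (D z)" and D0: "\<And>z. 0 \<le> D z"
    by (rule P.real_RN_deriv[OF J.finite_measure_axioms ac sets]) blast
  have dens: "joint = density indep (\<lambda>z. ennreal (D z))"
    by (rule trans[OF P.density_RN_deriv[OF ac sets, symmetric] density_cong[OF _ _ D_RN]]) auto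
  have intD: "integrable indep D"
  proof -
    have "space joint = UNIV" by (simp add: joint_def space_pair_measure)
    then have "1 = emeasure (density indep (\<lambda>z. ennreal (D z))) (space indep)"
      using J.emeasure_space_1 by (simp add: dens space_indep)
    also have "\<dots> = (\<integral>\<^sup>+z. ennreal (D z) \<partial>indep)"
      by (subst emeasure_density) (auto intro!: nn_integral_cong)
    finally show ?thesis
      using D0 by (intro integrableI_nn_integral_finite[where x=1]) auto
  qed
  define B where "B = {z. D z > 2}"
  have B [measurable]: "B \<in> sets indep"
  proof -
    have "{z \<in> space indep. D z > 2} \<in> sets indep" by measurable
    then show ?thesis by (simp add: B_def space_indep)
  qed
  \<comment> \<open>The integrand is nonnegative and positive exactly on \<open>B\<close>, while its
    integral is at most 0 by \<open>joint_le_indep\<close>. So \<open>B\<close> is null.\<close>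
  have "(\<integral>z. (D z - 2) * indicator B z \<partial>indep) = J.prob B - 2 * P.prob B"
  proof -
    have "J.prob B = (\<integral>z. indicator B z \<partial>joint)" using B sets by simp
    also have "\<dots> = (\<integral>z. D z * indicator B z \<partial>indep)"
      by (subst dens, subst integral_density) (auto simp: D0)
    finally have "J.prob B = (\<integral>z. D z * indicator B z \<partial>indep)" .
    moreover have "integrable indep (\<lambda>z. D z * indicator B z)"
      using intD by (rule Bochner_Integration.integrable_bound) (auto simp: indicator_def)
    ultimately show ?thesis
      using B by (simp add: left_diff_distrib P.emeasure_eq_measure)
  qed
  also have "\<dots> \<le> 0" using joint_le_indep[of B] B by (simp add: sets_indep)
  finally have "(\<integral>z. (D z - 2) * indicator B z \<partial>indep) = 0"
    by (intro antisym) (auto intro!: integral_nonneg_AE simp: B_def indicator_def)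
  moreover have "integrable indep (\<lambda>z. (D z - 2) * indicator B z)"
    by (rule Bochner_Integration.integrable_bound[OF intD]) (auto simp: indicator_def B_def)
  ultimately have "AE z in indep. (D z - 2) * indicator B z = 0"
    by (subst (asm) integral_nonneg_eq_0_iff_AE) (auto simp: B_def indicator_def)
  then have le: "AE z in indep. D z = min 2 (D z)"
    by eventually_elim (auto simp: B_def indicator_def min_def split: if_splits)
  have "joint = density indep (\<lambda>z. ennreal (min 2 (D z)))"
    unfolding dens by (intro density_cong) (use le in \<open>auto elim!: eventually_mono\<close>)
  with D D0 show thesis
    by (intro that[of "\<lambda>z. min 2 (D z)"]) (auto cong: measurable_cong_sets[OF sets_indep refl])
qed

end

section \<open>Dual representation of the mutual information\<close>

text \<open>Above 1, \<open>ln y\<close> is at most \<open>y - 1\<close>; below 1,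
  \<open>- ln y\<close> is at most \<open>1 / y - 1\<close>, which the factor \<open>y\<close> turns
  into \<open>1 - y\<close>. The bound makes \<open>D ln D\<close> integrable.\<close>

lemma abs_mult_ln_le:
  fixes y :: real
  assumes "0 \<le> y" "y \<le> 2"
  shows "\<bar>y * ln y\<bar> \<le> 2"
proof (cases "y = 0 \<or> 1 \<le> y")
  case True
  then show ?thesis
  proof
    assume y: "1 \<le> y"
    then have "0 \<le> ln y" "ln y \<le> 1" using ln_le_minus_one[of y] assms by auto
    then show ?thesis using mult_mono[of y 2 "ln y" 1] assms by (simp add: abs_mult)
  qed simp
next
  case False
  then have y: "0 < y" "y < 1" using assms by auto
  then have "- ln y \<le> 1 / y - 1" using ln_le_minus_one[of "1 / y"] by (simp add: ln_div)
  then have "y * (- ln y) \<le> y * (1 / y - 1)" using y by (intro mult_left_mono) auto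
  also have "\<dots> = 1 - y" using y by (simp add: field_simps)
  finally have "- (y * ln y) \<le> 1 - y" by simp
  moreover have "y * ln y \<le> 0" using y by (simp add: mult_nonneg_nonpos)
  ultimately show ?thesis using y by linarith
qed

text \<open>Young's inequality for the convex conjugates \<open>y ln y - y\<close> and
  \<open>exp g\<close>. It is \<open>ln t \<le> t - 1\<close> at \<open>t = exp g / y\<close>; for
  positive \<open>y\<close>, equality holds at \<open>g = ln y\<close>.\<close>

lemma fenchel_exp:
  fixes y g :: real
  assumes "0 \<le> y"
  shows "y * g - exp g + y \<le> y * ln y"
proof (cases "y = 0")
  case False
  with assms have y: "0 < y" by simp
  have "g - ln y \<le> exp g / y - 1"
    using ln_le_minus_one[of "exp g / y"] y by (simp add: ln_div)
  then have "y * (g - ln y) \<le> y * (exp g / y - 1)" using y by (intro mult_left_mono) auto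
  also have "\<dots> = exp g - y" using y by (simp add: field_simps)
  finally show ?thesis by (simp add: algebra_simps)
qed simp

text \<open>Near-equality in \<open>fenchel_exp\<close> at the test value \<open>ln (g + e)\<close>.
  The shift by \<open>e\<close> makes the logarithm Lipschitz with constant \<open>1 / e\<close>;
  with \<open>y \<le> 2\<close> the mismatch of the logarithms costs \<open>2 / e\<close> times the
  distance, and the difference of the linear terms costs the distance once more. The last
  \<open>e\<close> compensates the shift inside \<open>exp\<close>.\<close>

lemma fenchel_exp_gap:
  fixes y g e :: real
  assumes y: "0 \<le> y" "y \<le> 2" and g: "0 \<le> g" and e: "0 < e"
  shows "y * ln y \<le> (y * ln (g + e) - exp (ln (g + e)) + y) + (2 / e + 1) * \<bar>y - g\<bar> + e"
proof -
  have "ln (y + e) - ln (g + e) \<le> \<bar>y - g\<bar> / e"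
  proof -
    have "ln (y + e) - ln (g + e) = ln ((y + e) / (g + e))"
      using assms by (subst ln_div) auto
    also have "\<dots> \<le> (y + e) / (g + e) - 1" using assms by (intro ln_le_minus_one) auto
    also have "\<dots> = (y - g) / (g + e)" using assms by (simp add: field_simps)
    also have "\<dots> \<le> \<bar>y - g\<bar> / e" using assms by (intro frac_le) auto
    finally show ?thesis .
  qed
  then have "y * (ln (y + e) - ln (g + e)) \<le> 2 * (\<bar>y - g\<bar> / e)"
    using assms by (intro order_trans[OF mult_left_mono mult_right_mono]) auto
  moreover have "y * ln y \<le> y * ln (y + e)"
    using assms by (cases "y = 0") (auto intro!: mult_left_mono)
  moreover have "(2 / e + 1) * \<bar>y - g\<bar> = 2 * (\<bar>y - g\<bar> / e) + \<bar>y - g\<bar>"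
    by (simp add: field_simps)
  moreover have "exp (ln (g + e)) = g + e" using assms by simp
  moreover have "g - y \<le> \<bar>y - g\<bar>" by simp
  ultimately show ?thesis by (simp add: algebra_simps)
qed

text \<open>
  The optimal test function is $\ln D$; it is approximated by $\ln(g + 1/(m+1))$, with the positive
  part of a rational step function $g$ close to $D$ in $L^1$.
\<close>

definition test_fun :: "nat \<times> (rat \<times> rat) list \<times> (rat \<times> rat) list \<Rightarrow> real \<times> bool \<Rightarrow> real" where
  "test_fun = (\<lambda>(m, cs, ds) (x, b).
     ln (max 0 (step_fun (if b then cs else ds) x) + 1 / real (Suc m)))"

lemma measurable_test_fun [measurable]:
  "test_fun c \<in> borel_measurable (borel \<Otimes>\<^sub>M count_space UNIV)"
proof -
  obtain m cs ds where c: "c = (m, cs, ds)" by (cases c)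
  have "test_fun c = (\<lambda>z. if snd z then ln (max 0 (step_fun cs (fst z)) + 1 / real (Suc m))
      else ln (max 0 (step_fun ds (fst z)) + 1 / real (Suc m)))"
    by (auto simp: c test_fun_def fun_eq_iff)
  then show ?thesis by simp
qed

text \<open>The offset keeps the argument of the logarithm away from 0, and step functions are
  bounded. Boundedness makes \<open>test_fun\<close> admissible in
  \<open>dual_value_le_mi\<close>.\<close>

lemma test_fun_bounded: "\<exists>B. \<forall>z. \<bar>test_fun c z\<bar> \<le> B"
proof -
  obtain m cs ds where c: "c = (m, cs, ds)" by (cases c)
  obtain B1 B2 where B: "\<And>x. \<bar>step_fun cs x\<bar> \<le> B1" "\<And>x. \<bar>step_fun ds x\<bar> \<le> B2"
    using step_fun_bounded by metis
  let ?e = "1 / real (Suc m)" and ?C = "max B1 B2 + 1"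
  have "ln ?e \<le> test_fun c z \<and> test_fun c z \<le> ln (?C + ?e)" for z
  proof -
    obtain x b where z: "z = (x, b)" by (cases z)
    let ?s = "max 0 (step_fun (if b then cs else ds) x)"
    have "0 \<le> ?s" "?s \<le> ?C" using B(1)[of x] B(2)[of x] by (auto split: if_splits)
    then show ?thesis
      unfolding test_fun_def c z using of_nat_0_less_iff[of "Suc m"]
      by (auto simp del: of_nat_Suc intro!: ln_mono add_nonneg_pos)
  qed
  then have "\<bar>test_fun c z\<bar> \<le> \<bar>ln ?e\<bar> + \<bar>ln (?C + ?e)\<bar>" for z
    by (smt (verit))
  then show ?thesis by blast
qed

section \<open>Upper bound and attainment in the dual representation\<close>

context fair_bit_pair
begin

text \<open>Information and dual value become integrals over the same product law, so comparing them
  reduces to scalar inequalities at each point. The summand 1 of \<open>dual_value\<close> enters as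
  the integral of \<open>D\<close>.\<close>

lemma dual_value_density:
  obtains D where "D \<in> borel_measurable (borel \<Otimes>\<^sub>M count_space UNIV)"
    "\<And>z. 0 \<le> D z" "\<And>z. D z \<le> 2" "(\<integral>z. D z \<partial>indep) = 1" "mi = (\<integral>z. D z * ln (D z) \<partial>indep)"
    "\<And>G B. G \<in> borel_measurable (borel \<Otimes>\<^sub>M count_space UNIV) \<Longrightarrow> (\<And>z. \<bar>G z\<bar> \<le> B) \<Longrightarrow>
       integrable indep (\<lambda>z. D z * G z - exp (G z) + D z) \<and>
       dual_value G = (\<integral>z. D z * G z - exp (G z) + D z \<partial>indep)"
proof (rule joint_density)
  fix D assume D [measurable]: "D \<in> borel_measurable (borel \<Otimes>\<^sub>M count_space UNIV)"
    and D0: "\<And>z. 0 \<le> D z" and D2: "\<And>z. D z \<le> 2"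
    and dens: "joint = density indep (\<lambda>z. ennreal (D z))"
  have intD: "integrable indep D"
    using D0 D2 by (intro integrable_indep[where B=2]) auto
  have exp_joint: "expectation (\<lambda>\<omega>. G (X \<omega>, Y \<omega>)) = (\<integral>z. D z * G z \<partial>indep)"
    if [measurable]: "G \<in> borel_measurable (borel \<Otimes>\<^sub>M count_space UNIV)" for G :: "real \<times> bool \<Rightarrow> real"
    unfolding integral_joint[OF that, symmetric] dens by (subst integral_density) (auto simp: D0)
  have one: "(\<integral>z. D z \<partial>indep) = 1"
    using exp_joint[of "\<lambda>_. 1"] by (simp add: prob_space)
  have mi: "mi = (\<integral>z. D z * ln (D z) \<partial>indep)"
    unfolding mi_def mutual_information_def joint_def[symmetric] indep_def[symmetric] dens
    by (subst P.KL_density) (auto simp: D0 log_ln[symmetric])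
  show thesis
  proof (rule that[OF D D0 D2 one mi])
    fix G :: "real \<times> bool \<Rightarrow> real" and B
    assume [measurable]: "G \<in> borel_measurable (borel \<Otimes>\<^sub>M count_space UNIV)" and B: "\<And>z. \<bar>G z\<bar> \<le> B"
    have DG: "integrable indep (\<lambda>z. D z * G z)"
      using D0 D2 B by (intro integrable_indep[where B="2 * B"]) (auto simp: abs_mult intro!: mult_mono)
    have eG: "integrable indep (\<lambda>z. exp (G z))"
      using B by (intro integrable_indep[where B="exp B"]) (auto intro: order_trans[OF abs_ge_self])
    show "integrable indep (\<lambda>z. D z * G z - exp (G z) + D z) \<and>
       dual_value G = (\<integral>z. D z * G z - exp (G z) + D z \<partial>indep)"
      unfolding dual_value_def using DG eG intD
      by (simp add: exp_joint one integral_indep[OF _ eG])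
  qed
qed

lemma integrable_mult_ln:
  fixes D :: "real \<times> bool \<Rightarrow> real"
  assumes [measurable]: "D \<in> borel_measurable (borel \<Otimes>\<^sub>M count_space UNIV)"
    and "\<And>z. 0 \<le> D z" "\<And>z. D z \<le> 2"
  shows "integrable indep (\<lambda>z. D z * ln (D z))"
  using assms by (intro integrable_indep[where B=2] abs_mult_ln_le) auto

text \<open>Integration of \<open>fenchel_exp\<close> with \<open>y = D z\<close> and
  \<open>g = G z\<close>.\<close>

lemma dual_value_le_mi:
  assumes "G \<in> borel_measurable (borel \<Otimes>\<^sub>M count_space UNIV)" "\<And>z. \<bar>G z\<bar> \<le> B"
  shows "dual_value G \<le> mi"
proof (rule dual_value_density)
  fix D assume D: "D \<in> borel_measurable (borel \<Otimes>\<^sub>M count_space UNIV)"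
    "\<And>z. 0 \<le> D z" "\<And>z. D z \<le> 2" "mi = (\<integral>z. D z * ln (D z) \<partial>indep)"
    and G: "\<And>G B. G \<in> borel_measurable (borel \<Otimes>\<^sub>M count_space UNIV) \<Longrightarrow> (\<And>z. \<bar>G z\<bar> \<le> B) \<Longrightarrow>
       integrable indep (\<lambda>z. D z * G z - exp (G z) + D z) \<and>
       dual_value G = (\<integral>z. D z * G z - exp (G z) + D z \<partial>indep)"
  show ?thesis
    unfolding D(4) conjunct2[OF G[OF assms]]
    using D G[OF assms] by (intro integral_mono integrable_mult_ln fenchel_exp) auto
qed

lemma mi_nonneg: "0 \<le> mi"
  using dual_value_le_mi[of "\<lambda>_. 0" 0] by (simp add: dual_value_def prob_space)

text \<open>From \<open>D \<le> 2\<close> and the fact that \<open>D\<close> integrates to 1. The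
  bound is uniform in the supersample, which later gives integrability over it.\<close>

lemma mi_le_ln_2: "mi \<le> ln 2"
proof (rule dual_value_density)
  fix D assume D: "D \<in> borel_measurable (borel \<Otimes>\<^sub>M count_space UNIV)"
    "\<And>z. 0 \<le> D z" "\<And>z. D z \<le> 2" "(\<integral>z. D z \<partial>indep) = 1" "mi = (\<integral>z. D z * ln (D z) \<partial>indep)"
  have "mi \<le> (\<integral>z. D z * ln 2 \<partial>indep)"
    unfolding D(5)
  proof (rule integral_mono)
    show "D z * ln (D z) \<le> D z * ln 2" for z
      using D(2,3)[of z] by (cases "D z = 0") (auto intro!: mult_left_mono)
    show "integrable indep (\<lambda>z. D z * ln 2)"
      using D by (intro integrable_mult_left integrable_indep[where B=2]) auto
  qed (use D in \<open>intro integrable_mult_ln\<close>)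
  then show ?thesis using D(4) by simp
qed

lemma dual_value_approx:
  assumes "e > 0"
  shows "\<exists>c. mi - e < dual_value (test_fun c)"
proof (rule dual_value_density)
  fix D assume D [measurable]: "D \<in> borel_measurable (borel \<Otimes>\<^sub>M count_space UNIV)"
    and D0: "\<And>z. 0 \<le> D z" and D2: "\<And>z. D z \<le> 2" and mi: "mi = (\<integral>z. D z * ln (D z) \<partial>indep)"
    and G: "\<And>G B. G \<in> borel_measurable (borel \<Otimes>\<^sub>M count_space UNIV) \<Longrightarrow> (\<And>z. \<bar>G z\<bar> \<le> B) \<Longrightarrow>
       integrable indep (\<lambda>z. D z * G z - exp (G z) + D z) \<and>
       dual_value G = (\<integral>z. D z * G z - exp (G z) + D z \<partial>indep)"
  obtain m where m: "1 / real (Suc m) < e / 2"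
    using assms nat_approx_posE[of "e / 2"] by auto
  \<comment> \<open>\<open>k\<close> is the shift in \<open>fenchel_exp_gap\<close> and costs less
    than half of \<open>e\<close>; \<open>d\<close> is the L1 tolerance that the coefficient
    \<open>2 / k + 1\<close> of that lemma turns into the other half.\<close>
  define k where "k = 1 / real (Suc m)"
  have k: "0 < k" "k < e / 2" using m by (auto simp: k_def)
  define K where "K = 2 / k + 1"
  define d where "d = e / 2 / K"
  have d: "0 < d" "(2 / k + 1) * d = e / 2"
  proof -
    have "K > 0" using k by (simp add: K_def add_pos_pos)
    then show "0 < d" "(2 / k + 1) * d = e / 2"
      using assms unfolding K_def[symmetric] by (simp_all add: d_def)
  qed
  let ?P = "distr M borel X"
  interpret X: prob_space ?P by (rule prob_space_distr) simp
  \<comment> \<open>One step function for each bit value, both under the law of \<open>X\<close>: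
    the product law averages the two errors, so the total error is again below
    \<open>d\<close>.\<close>
  have "\<exists>cs. (\<integral>x. \<bar>D (x, b) - step_fun cs x\<bar> \<partial>?P) < d" for b
  proof -
    have "integrable ?P (\<lambda>x. D (x, b))"
      using D0 D2 by (intro X.integrable_const_bound[where B=2]) auto
    then show ?thesis
      using step_approx_integrable[OF X.finite_measure_axioms] d by (auto simp: step_approx_def)
  qed
  then obtain cs where cs: "\<And>b. (\<integral>x. \<bar>D (x, b) - step_fun (cs b) x\<bar> \<partial>?P) < d"
    by metis
  define g where "g = (\<lambda>(x, b). max 0 (step_fun (cs b) x))"
  have [measurable]: "g \<in> borel_measurable (borel \<Otimes>\<^sub>M count_space UNIV)"
  proof -
    have "g = (\<lambda>z. if snd z then max 0 (step_fun (cs True) (fst z))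
        else max 0 (step_fun (cs False) (fst z)))"
      by (auto simp: g_def fun_eq_iff)
    then show ?thesis by simp
  qed
  let ?c = "(m, cs True, cs False)"
  have test: "test_fun ?c = (\<lambda>z. ln (g z + k))"
    by (auto simp: test_fun_def g_def k_def fun_eq_iff)
  obtain B1 B2 where B: "\<And>x. \<bar>step_fun (cs True) x\<bar> \<le> B1" "\<And>x. \<bar>step_fun (cs False) x\<bar> \<le> B2"
    using step_fun_bounded by metis
  have g0: "0 \<le> g z" for z by (auto simp: g_def split: prod.splits)
  have gB: "g z \<le> max B1 B2" for z
  proof -
    obtain x b where "z = (x, b)" by (cases z)
    then show ?thesis using B(1)[of x] B(2)[of x] by (cases b) (auto simp: g_def)
  qed
  have int_diff: "integrable indep (\<lambda>z. \<bar>D z - g z\<bar>)"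
  proof (rule integrable_indep)
    show "\<bar>\<bar>D z - g z\<bar>\<bar> \<le> 2 + max B1 B2" for z
      using D0[of z] D2[of z] g0[of z] gB[of z] by linarith
  qed measurable
  have diff: "(\<integral>z. \<bar>D z - g z\<bar> \<partial>indep) < d"
  proof -
    have E: "integrable M (\<lambda>\<omega>. \<bar>D (X \<omega>, b) - step_fun (cs b) (X \<omega>)\<bar>)" for b
    proof (rule integrable_const_bound[where B="2 + max B1 B2"])
      show "AE \<omega> in M. norm \<bar>D (X \<omega>, b) - step_fun (cs b) (X \<omega>)\<bar> \<le> 2 + max B1 B2"
      proof (rule AE_I2)
        fix \<omega>
        show "norm \<bar>D (X \<omega>, b) - step_fun (cs b) (X \<omega>)\<bar> \<le> 2 + max B1 B2"
          using B(1)[of "X \<omega>"] B(2)[of "X \<omega>"] D0[of "(X \<omega>, b)"] D2[of "(X \<omega>, b)"] by (cases b) auto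
      qed
    qed measurable
    have cs': "expectation (\<lambda>\<omega>. \<bar>D (X \<omega>, b) - step_fun (cs b) (X \<omega>)\<bar>) < d" for b
      using cs[of b] by (subst (asm) integral_distr) auto
    have "(\<integral>z. \<bar>D z - g z\<bar> \<partial>indep)
        = expectation (\<lambda>\<omega>. (\<bar>D (X \<omega>, True) - g (X \<omega>, True)\<bar> + \<bar>D (X \<omega>, False) - g (X \<omega>, False)\<bar>) / 2)"
      by (rule integral_indep[OF _ int_diff]) measurable
    also have "\<dots> \<le> expectation (\<lambda>\<omega>. (\<bar>D (X \<omega>, True) - step_fun (cs True) (X \<omega>)\<bar>
        + \<bar>D (X \<omega>, False) - step_fun (cs False) (X \<omega>)\<bar>) / 2)"
    proof (rule integral_mono)
      \<comment> \<open>As \<open>D\<close> is nonnegative, taking the positive part of the step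
        function does not increase the distance.\<close>
      have [simp]: "\<bar>D (x, b) - g (x, b)\<bar> \<le> \<bar>D (x, b) - step_fun (cs b) x\<bar>" for x b
        using D0[of "(x, b)"] by (auto simp: g_def max_def)
      show "(\<bar>D (X \<omega>, True) - g (X \<omega>, True)\<bar> + \<bar>D (X \<omega>, False) - g (X \<omega>, False)\<bar>) / 2
        \<le> (\<bar>D (X \<omega>, True) - step_fun (cs True) (X \<omega>)\<bar>
        + \<bar>D (X \<omega>, False) - step_fun (cs False) (X \<omega>)\<bar>) / 2" for \<omega>
        by (intro divide_right_mono add_mono) auto
      show "integrable M (\<lambda>\<omega>. (\<bar>D (X \<omega>, True) - g (X \<omega>, True)\<bar> + \<bar>D (X \<omega>, False) - g (X \<omega>, False)\<bar>) / 2)"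
      proof -
        have "integrable M (\<lambda>\<omega>. \<bar>D (X \<omega>, b) - g (X \<omega>, b)\<bar>)" for b
          by (rule Bochner_Integration.integrable_bound[OF E[of b]]) auto
        then show ?thesis by auto
      qed
    qed (use E in auto)
    also have "\<dots> < d" using cs'[of True] cs'[of False] E by simp
    finally show ?thesis .
  qed
  obtain B where "\<And>z. \<bar>test_fun ?c z\<bar> \<le> B" using test_fun_bounded by blast
  note G' = G[OF measurable_test_fun this]
  define F where "F z = D z * test_fun ?c z - exp (test_fun ?c z) + D z" for z
  have F: "integrable indep F" "dual_value (test_fun ?c) = (\<integral>z. F z \<partial>indep)"
    using G' by (simp_all add: F_def[abs_def])
  have "mi \<le> (\<integral>z. F z + (2 / k + 1) * \<bar>D z - g z\<bar> + k \<partial>indep)"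
    unfolding mi
  proof (rule integral_mono)
    show "D z * ln (D z) \<le> F z + (2 / k + 1) * \<bar>D z - g z\<bar> + k" for z
      unfolding test F_def by (intro fenchel_exp_gap D0 D2 g0 k)
    show "integrable indep (\<lambda>z. F z + (2 / k + 1) * \<bar>D z - g z\<bar> + k)"
      using F(1) int_diff
      by (intro Bochner_Integration.integrable_add integrable_mult_right) auto
  qed (intro integrable_mult_ln D D0 D2)
  also have "\<dots> = dual_value (test_fun ?c) + (2 / k + 1) * (\<integral>z. \<bar>D z - g z\<bar> \<partial>indep) + k"
    using F int_diff P.prob_space by simp
  also have "(2 / k + 1) * (\<integral>z. \<bar>D z - g z\<bar> \<partial>indep) \<le> e / 2"
    unfolding d(2)[symmetric] using diff k by (intro mult_left_mono) auto
  finally have "mi - e < dual_value (test_fun ?c)" using k by linarith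
  then show ?thesis by blast
qed

text \<open>The index type of \<open>c\<close> is countable and the test functions do not involve
  \<open>M\<close>, \<open>X\<close> or \<open>Y\<close>. This is the form from which measurability
  in the supersample is read off.\<close>

lemma mi_eq_SUP: "mi = (SUP c. dual_value (test_fun c))"
proof (rule antisym)
  have bdd: "bdd_above (range (\<lambda>c. dual_value (test_fun c)))"
    using dual_value_le_mi[OF measurable_test_fun] test_fun_bounded by (intro bdd_aboveI[of _ mi]) blast
  show "mi \<le> (SUP c. dual_value (test_fun c))"
  proof (rule field_le_epsilon)
    fix e :: real assume "e > 0"
    then obtain c where "mi - e < dual_value (test_fun c)" using dual_value_approx by blast
    also have "\<dots> \<le> (SUP c. dual_value (test_fun c))" by (rule cSUP_upper[OF UNIV_I bdd])
    finally show "mi \<le> (SUP c. dual_value (test_fun c)) + e" by simp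
  qed
  show "(SUP c. dual_value (test_fun c)) \<le> mi"
    using dual_value_le_mi[OF measurable_test_fun] test_fun_bounded by (intro cSUP_least) blast+
qed

end

text \<open>Hoeffding's lemma for a fair sign: parameter \<open>1 / 2\<close> and width
  \<open>2 * x\<close> give \<open>(2 * x)^2 / 8 = x^2 / 2\<close>. The auxiliary bound is for
  nonnegative width, and evenness of \<open>cosh\<close> covers negative \<open>x\<close>.\<close>

lemma cosh_le_exp_square: "cosh (x::real) \<le> exp (x\<^sup>2 / 2)"
proof -
  have *: "cosh x \<le> exp (x\<^sup>2 / 2)" if "0 \<le> x" for x :: real
  proof -
    have pos: "0 < 1 + 1 / 2 * (exp (2 * x) - 1)"
    proof -
      have *: "1 + 1 / 2 * (exp (2 * x) - 1) = (1 + exp (2 * x)) / 2" by (simp add: field_simps)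
      show ?thesis unfolding * by (simp add: add_pos_pos)
    qed
    have "- (2 * x) * (1 / 2) + ln (1 + 1 / 2 * (exp (2 * x) - 1)) \<le> (2 * x)\<^sup>2 / 8"
      using that by (intro Hoeffdings_lemma_aux) auto
    then have "ln (1 + 1 / 2 * (exp (2 * x) - 1)) \<le> x + x\<^sup>2 / 2"
      by (simp add: power_mult_distrib)
    then have "1 + 1 / 2 * (exp (2 * x) - 1) \<le> exp (x + x\<^sup>2 / 2)"
      using pos by (metis exp_le_cancel_iff exp_ln)
    moreover have "1 + 1 / 2 * (exp (2 * x) - 1) = exp x * cosh x"
      by (simp add: cosh_field_def field_simps mult_exp_exp)
    ultimately show ?thesis by (simp add: exp_add)
  qed
  show ?thesis using *[of x] *[of "- x"] by (cases "0 \<le> x") auto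
qed

section \<open>The signed mean is controlled by the information\<close>

context fair_bit_pair
begin

lemma signed_expectation_le:
  assumes X1: "\<And>\<omega>. \<omega> \<in> space M \<Longrightarrow> \<bar>X \<omega>\<bar> \<le> 1"
  shows "\<bar>expectation (\<lambda>\<omega>. (if Y \<omega> then - 1 else 1) * X \<omega>)\<bar> \<le> sqrt (2 * mi)"
proof -
  define E where "E = expectation (\<lambda>\<omega>. (if Y \<omega> then - 1 else 1) * X \<omega>)"
  \<comment> \<open>The test function has to be bounded at every real, while \<open>X\<close> is
    bounded only on \<open>space M\<close>; clipping to \<open>[-1, 1]\<close> changes nothing
    there.\<close>
  define c :: "real \<Rightarrow> real" where "c x = max (- 1) (min 1 x)" for x
  have c: "c (X \<omega>) = X \<omega>" if "\<omega> \<in> space M" for \<omega>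
    using X1[OF that] by (auto simp: c_def)
  have c1: "\<bar>c x\<bar> \<le> 1" for x by (auto simp: c_def)
  have [measurable]: "c \<in> borel_measurable borel" by (simp add: c_def[abs_def])
  \<comment> \<open>Subtracting \<open>E^2 / 2\<close> normalises the exponential moment to at most
    1. The joint mean of \<open>G\<close> is \<open>E * E - E^2 / 2 = E^2 / 2\<close>, the source of
    the factor 2 under the root.\<close>
  define G where "G = (\<lambda>(x, b). E * ((if b then - 1 else 1) * c x) - E\<^sup>2 / 2)"
  have G [measurable]: "G \<in> borel_measurable (borel \<Otimes>\<^sub>M count_space UNIV)"
    unfolding G_def by measurable
  have Gb: "\<bar>G z\<bar> \<le> \<bar>E\<bar> + E\<^sup>2 / 2" for z
  proof -
    obtain x b where z: "z = (x, b)" by (cases z)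
    have "\<bar>E * ((if b then - 1 else 1) * c x)\<bar> \<le> \<bar>E\<bar>"
      using mult_left_mono[OF c1[of x], of "\<bar>E\<bar>"] by (cases b) (auto simp: abs_mult)
    moreover have "0 \<le> E\<^sup>2 / 2" by simp
    ultimately show ?thesis unfolding z G_def split_conv by linarith
  qed
  have "expectation (\<lambda>\<omega>. G (X \<omega>, Y \<omega>)) = E\<^sup>2 / 2"
  proof -
    have "expectation (\<lambda>\<omega>. G (X \<omega>, Y \<omega>))
        = expectation (\<lambda>\<omega>. E * ((if Y \<omega> then - 1 else 1) * X \<omega>) - E\<^sup>2 / 2)"
      by (intro Bochner_Integration.integral_cong) (auto simp: G_def c)
    also have "\<dots> = E * E - E\<^sup>2 / 2"
    proof (subst Bochner_Integration.integral_diff)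
      have "integrable M (\<lambda>\<omega>. (if Y \<omega> then - 1 else 1) * X \<omega>)"
        using X1 by (intro integrable_const_bound[where B=1]) auto
      then show "integrable M (\<lambda>\<omega>. E * ((if Y \<omega> then - 1 else 1) * X \<omega>))"
        by (rule integrable_mult_right)
    qed (simp_all add: E_def prob_space del: mult_minus_left)
    finally show ?thesis by (simp add: power2_eq_square)
  qed
  moreover have "expectation (\<lambda>\<omega>. (exp (G (X \<omega>, True)) + exp (G (X \<omega>, False))) / 2) \<le> 1"
  proof -
    have le: "(exp (G (x, True)) + exp (G (x, False))) / 2 \<le> 1" for x
    proof -
      \<comment> \<open>Averaging over the fair bit leaves a hyperbolic cosine, whose growth the
        factor \<open>exp (- (E^2 / 2))\<close> absorbs because
        \<open>\<bar>c x\<bar> \<le> 1\<close>.\<close>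
      have "(exp (G (x, True)) + exp (G (x, False))) / 2 = cosh (E * c x) * exp (- (E\<^sup>2 / 2))"
        by (simp add: G_def cosh_field_def field_simps mult_exp_exp)
      also have "\<dots> \<le> exp ((E * c x)\<^sup>2 / 2) * exp (- (E\<^sup>2 / 2))"
        by (intro mult_right_mono cosh_le_exp_square) auto
      also have "\<dots> = exp ((E * c x)\<^sup>2 / 2 - E\<^sup>2 / 2)"
        by (simp add: mult_exp_exp)
      also have "\<dots> \<le> 1"
        using mult_left_mono[of "(c x)\<^sup>2" 1 "E\<^sup>2"] c1[of x]
        by (simp add: power_mult_distrib abs_square_le_1)
      finally show ?thesis .
    qed
    have "expectation (\<lambda>\<omega>. (exp (G (X \<omega>, True)) + exp (G (X \<omega>, False))) / 2) \<le> expectation (\<lambda>_. 1)"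
    proof (rule integral_mono[OF _ _ le])
      show "integrable M (\<lambda>\<omega>. (exp (G (X \<omega>, True)) + exp (G (X \<omega>, False))) / 2)"
        using le by (intro integrable_const_bound[where B=1]) (auto simp: add_nonneg_nonneg)
    qed simp
    then show ?thesis by (simp add: prob_space)
  qed
  ultimately have "E\<^sup>2 / 2 \<le> mi"
    using dual_value_le_mi[OF G Gb] by (simp add: dual_value_def)
  then have "sqrt (E\<^sup>2) \<le> sqrt (2 * mi)" by (intro real_sqrt_le_mono) simp
  then show ?thesis by (simp add: E_def)
qed

end

section \<open>The supersample\<close>

text \<open>Integrand and measure both vary with \<open>x\<close>. Carrying \<open>K x\<close> to
  the product space by \<open>y -> (x, y)\<close> makes the integrand fixed, and integration of a
  fixed function is measurable on \<open>subprob_algebra\<close>.\<close>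

lemma borel_measurable_integral_kernel:
  fixes f :: "'a \<times> 'b \<Rightarrow> real"
  assumes f [measurable]: "f \<in> borel_measurable (M \<Otimes>\<^sub>M N)"
    and K [measurable]: "K \<in> M \<rightarrow>\<^sub>M subprob_algebra N"
  shows "(\<lambda>x. \<integral>y. f (x, y) \<partial>K x) \<in> borel_measurable M"
proof -
  have [measurable]: "(\<lambda>x. distr (K x) (M \<Otimes>\<^sub>M N) (\<lambda>y. (x, y))) \<in> M \<rightarrow>\<^sub>M subprob_algebra (M \<Otimes>\<^sub>M N)"
    by (rule measurable_distr2[where M=N]) (simp_all add: split_beta')
  have "(\<lambda>x. \<integral>z. f z \<partial>distr (K x) (M \<Otimes>\<^sub>M N) (\<lambda>y. (x, y))) \<in> borel_measurable M"
    by (rule measurable_compose[OF _ integral_measurable_subprob_algebra]) measurable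
  then show ?thesis
  proof (rule measurable_cong[THEN iffD1, rotated])
    fix x assume x: "x \<in> space M"
    have "sets (K x) = sets N" using sets_kernel[OF K x] .
    note [measurable_cong] = this
    show "(\<integral>z. f z \<partial>distr (K x) (M \<Otimes>\<^sub>M N) (\<lambda>y. (x, y))) = (\<integral>y. f (x, y) \<partial>K x)"
      using x by (intro integral_distr) measurable
  qed
qed

text \<open>Jensen's inequality for the square root is the nonnegativity of the variance of
  \<open>sqrt f\<close>.\<close>

lemma (in prob_space) expectation_sqrt_le:
  assumes [measurable]: "f \<in> borel_measurable M" and f: "\<And>x. x \<in> space M \<Longrightarrow> 0 \<le> f x \<and> f x \<le> B"
  shows "expectation (\<lambda>x. sqrt (f x)) \<le> sqrt (expectation f)"
proof -
  have int: "integrable M (\<lambda>x. sqrt (f x))"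
    by (rule integrable_const_bound[where B="sqrt B"]) (auto intro!: AE_I2 simp: f)
  have sq: "expectation (\<lambda>x. (sqrt (f x))\<^sup>2) = expectation f"
    by (intro Bochner_Integration.integral_cong) (auto simp: f)
  have "integrable M (\<lambda>x. (sqrt (f x))\<^sup>2)"
    by (rule integrable_const_bound[where B=B]) (auto intro!: AE_I2 simp: f)
  from variance_eq[OF int this] variance_positive[of "\<lambda>x. sqrt (f x)"]
  have "(expectation (\<lambda>x. sqrt (f x)))\<^sup>2 \<le> expectation f" by (simp add: sq)
  then show ?thesis by (rule real_le_rsqrt)
qed

locale supersample_setting =
  fixes n :: nat and \<mu> :: "'z measure" and Wsp :: "'w measure"
    and A :: "(nat \<Rightarrow> 'z) \<Rightarrow> 'w measure" and loss :: "'w \<Rightarrow> 'z \<Rightarrow> real"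
  assumes n_pos: "n \<ge> 1"
    and mu: "prob_space \<mu>"
    and A_kernel: "A \<in> sample_space n \<mu> \<rightarrow>\<^sub>M prob_algebra Wsp"
    and loss_meas: "(\<lambda>(w, z). loss w z) \<in> borel_measurable (Wsp \<Otimes>\<^sub>M \<mu>)"
    and loss_bounded: "\<And>w z. w \<in> space Wsp \<Longrightarrow> z \<in> space \<mu> \<Longrightarrow> 0 \<le> loss w z \<and> loss w z \<le> 1"
begin

abbreviation S where "S \<equiv> sample_space n \<mu>"
abbreviation SS where "SS \<equiv> supersample_space n \<mu>"
abbreviation bits :: "(nat \<Rightarrow> bool) set" where "bits \<equiv> PiE {..<n} (\<lambda>_. UNIV)"

sublocale mu: prob_space \<mu> by (rule mu)

sublocale S: prob_space S
  unfolding sample_space_def by (intro prob_space_PiM mu)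

sublocale SS: prob_space SS
  unfolding supersample_space_def by (intro prob_space_PiM mu)

lemma finite_bits: "finite bits" by (intro finite_PiE) auto

lemma bits_nonempty: "bits \<noteq> {}" by (simp add: PiE_eq_empty_iff)

sublocale U: prob_space "U_measure n"
  unfolding U_measure_def by (intro prob_space_uniform_count_measure finite_bits bits_nonempty)

lemma space_U: "space (U_measure n) = bits"
  by (simp add: U_measure_def space_uniform_count_measure)

lemma sets_U [measurable_cong]: "sets (U_measure n) = sets (count_space bits)"
  by (simp add: U_measure_def sets_uniform_count_measure)

lemma measurable_loss [measurable (raw)]:
  assumes "f \<in> M \<rightarrow>\<^sub>M Wsp" "g \<in> M \<rightarrow>\<^sub>M \<mu>"
  shows "(\<lambda>x. loss (f x) (g x)) \<in> borel_measurable M"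
  using measurable_compose[OF measurable_Pair[OF assms] loss_meas] by simp

lemma loss_abs: "w \<in> space Wsp \<Longrightarrow> z \<in> space \<mu> \<Longrightarrow> \<bar>loss w z\<bar> \<le> 1"
  using loss_bounded[of w z] by auto

lemma loss_diff_abs:
  "w \<in> space Wsp \<Longrightarrow> z \<in> space \<mu> \<Longrightarrow> z' \<in> space \<mu> \<Longrightarrow> \<bar>loss w z - loss w z'\<bar> \<le> 1"
  using loss_bounded[of w z] loss_bounded[of w z'] by (auto simp: abs_le_iff)

lemma A_sub [measurable]: "A \<in> S \<rightarrow>\<^sub>M subprob_algebra Wsp"
  by (rule measurable_prob_algebraD[OF A_kernel])

lemma prob_space_A: "s \<in> space S \<Longrightarrow> prob_space (A s)"
  and sets_A: "s \<in> space S \<Longrightarrow> sets (A s) = sets Wsp"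
  using measurable_space[OF A_kernel, of s] by (auto simp: space_prob_algebra)

lemma space_A: "s \<in> space S \<Longrightarrow> space (A s) = space Wsp"
  by (rule sets_eq_imp_space_eq[OF sets_A])

lemma measurable_Pair_A:
  assumes "s \<in> space S" "x \<in> space M"
  shows "(\<lambda>w. (x, w)) \<in> A s \<rightarrow>\<^sub>M M \<Otimes>\<^sub>M Wsp"
  using assms by (intro measurable_Pair measurable_const measurable_ident_sets sets_A)

lemma measurable_S_component [measurable]: "i < n \<Longrightarrow> (\<lambda>s. s i) \<in> S \<rightarrow>\<^sub>M \<mu>"
  unfolding sample_space_def by (rule measurable_component_singleton) simp

lemma measurable_SS_component [measurable]: "i < n \<Longrightarrow> (\<lambda>zt. zt (i, b)) \<in> SS \<rightarrow>\<^sub>M \<mu>"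
  unfolding supersample_space_def by (rule measurable_component_singleton) simp

lemma S_component_space: "s \<in> space S \<Longrightarrow> i < n \<Longrightarrow> s i \<in> space \<mu>"
  using measurable_space[OF measurable_S_component] .

lemma SS_component_space: "zt \<in> space SS \<Longrightarrow> i < n \<Longrightarrow> zt (i, b) \<in> space \<mu>"
  using measurable_space[OF measurable_SS_component] .

lemma measurable_select [measurable]: "(\<lambda>zt. select n zt u) \<in> SS \<rightarrow>\<^sub>M S"
  unfolding select_def sample_space_def by (rule measurable_restrict) auto

lemma select_space: "zt \<in> space SS \<Longrightarrow> select n zt u \<in> space S"
  using measurable_space[OF measurable_select] .

lemma integrable_A:
  assumes "s \<in> space S" "f \<in> borel_measurable Wsp" "\<And>w. w \<in> space Wsp \<Longrightarrow> \<bar>f w\<bar> \<le> (B::real)"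
  shows "integrable (A s) f"
proof -
  interpret prob_space "A s" by (rule prob_space_A[OF assms(1)])
  show ?thesis
    using assms by (intro integrable_const_bound[where B=B] AE_I2)
      (auto simp: space_A cong: measurable_cong_sets[OF sets_A refl])
qed

text \<open>The bit space is discrete, so measurability in \<open>u\<close> is automatic and only
  the values have to be checked.\<close>

lemma kernel_cond_UW:
  assumes zt: "zt \<in> space SS"
  shows "(\<lambda>u. distr (A (select n zt u)) (U_measure n \<Otimes>\<^sub>M Wsp) (\<lambda>w. (u, w)))
    \<in> U_measure n \<rightarrow>\<^sub>M prob_algebra (U_measure n \<Otimes>\<^sub>M Wsp)"
proof -
  have "(\<lambda>u. distr (A (select n zt u)) (U_measure n \<Otimes>\<^sub>M Wsp) (\<lambda>w. (u, w)))
      \<in> bits \<rightarrow> space (prob_algebra (U_measure n \<Otimes>\<^sub>M Wsp))"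
  proof
    fix u assume u: "u \<in> bits"
    have "(\<lambda>w. (u, w)) \<in> A (select n zt u) \<rightarrow>\<^sub>M U_measure n \<Otimes>\<^sub>M Wsp"
      using u by (intro measurable_Pair_A select_space zt) (simp add: space_U)
    then show "distr (A (select n zt u)) (U_measure n \<Otimes>\<^sub>M Wsp) (\<lambda>w. (u, w))
        \<in> space (prob_algebra (U_measure n \<Otimes>\<^sub>M Wsp))"
      using prob_space.prob_space_distr[OF prob_space_A[OF select_space[OF zt]]]
      by (auto simp: space_prob_algebra)
  qed
  then show ?thesis
    by (simp add: measurable_cong_sets[OF sets_U refl])
qed

lemma U_in_prob_algebra: "U_measure n \<in> space (prob_algebra (U_measure n))"
  using U.prob_space_axioms by (simp add: space_prob_algebra)

lemma prob_space_cond_UW: "zt \<in> space SS \<Longrightarrow> prob_space (cond_UW n Wsp A zt)"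
  unfolding cond_UW_def by (rule prob_space_bind'[OF U_in_prob_algebra kernel_cond_UW])

lemma sets_cond_UW: "zt \<in> space SS \<Longrightarrow> sets (cond_UW n Wsp A zt) = sets (U_measure n \<Otimes>\<^sub>M Wsp)"
  unfolding cond_UW_def by (rule sets_bind'[OF U_in_prob_algebra kernel_cond_UW])

lemma space_cond_UW: "zt \<in> space SS \<Longrightarrow> space (cond_UW n Wsp A zt) = bits \<times> space Wsp"
  by (simp add: sets_eq_imp_space_eq[OF sets_cond_UW] space_pair_measure space_U)

text \<open>The bits are uniform on a finite set, so the conditional law integrates as a finite
  average of integrals against the measurable kernel \<open>A\<close>. All later statements about
  dependence on \<open>zt\<close> go through this formula.\<close>

lemma integral_cond_UW:
  fixes f :: "(nat \<Rightarrow> bool) \<times> 'w \<Rightarrow> real"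
  assumes zt: "zt \<in> space SS" and f [measurable]: "f \<in> borel_measurable (U_measure n \<Otimes>\<^sub>M Wsp)"
    and B: "\<And>u w. u \<in> bits \<Longrightarrow> w \<in> space Wsp \<Longrightarrow> \<bar>f (u, w)\<bar> \<le> B"
  shows "(\<integral>uw. f uw \<partial>cond_UW n Wsp A zt)
    = (\<Sum>u\<in>bits. \<integral>w. f (u, w) \<partial>A (select n zt u)) / card bits"
proof -
  have K: "(\<lambda>u. distr (A (select n zt u)) (U_measure n \<Otimes>\<^sub>M Wsp) (\<lambda>w. (u, w)))
    \<in> U_measure n \<rightarrow>\<^sub>M subprob_algebra (U_measure n \<Otimes>\<^sub>M Wsp)"
    by (rule measurable_prob_algebraD[OF kernel_cond_UW[OF zt]])
  have "(\<integral>uw. f uw \<partial>cond_UW n Wsp A zt)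
      = (\<integral>u. (\<integral>uw. f uw \<partial>distr (A (select n zt u)) (U_measure n \<Otimes>\<^sub>M Wsp) (\<lambda>w. (u, w))) \<partial>U_measure n)"
    unfolding cond_UW_def
  proof (rule integral_bind[OF f _ K, where B=B and B'=1])
    show "\<bar>f x\<bar> \<le> B" if "x \<in> space (U_measure n \<Otimes>\<^sub>M Wsp)" for x
      using that B by (auto simp: space_pair_measure space_U)
    show "finite_measure (U_measure n)" by (rule U.finite_measure_axioms)
    show "AE u in U_measure n.
        emeasure (distr (A (select n zt u)) (U_measure n \<Otimes>\<^sub>M Wsp) (\<lambda>w. (u, w)))
          (space (distr (A (select n zt u)) (U_measure n \<Otimes>\<^sub>M Wsp) (\<lambda>w. (u, w)))) \<le> ennreal 1"
      using subprob_space.emeasure_space_le_1[OF subprob_space_kernel[OF K]] by (intro AE_I2) simp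
  qed
  also have "\<dots> = (\<integral>u. (\<integral>w. f (u, w) \<partial>A (select n zt u)) \<partial>U_measure n)"
    by (intro Bochner_Integration.integral_cong refl integral_distr f measurable_Pair_A select_space zt)
  also have "\<dots> = (\<Sum>u\<in>bits. \<integral>w. f (u, w) \<partial>A (select n zt u)) / card bits"
    unfolding U_measure_def by (rule integral_uniform_count_measure[OF finite_bits])
  finally show ?thesis .
qed

lemma measurable_DeltaL [measurable]:
  assumes "zt \<in> space SS" "i < n"
  shows "DeltaL loss zt i \<in> borel_measurable (U_measure n \<Otimes>\<^sub>M Wsp)"
  unfolding DeltaL_def[abs_def] using SS_component_space[OF assms] by measurable

lemma measurable_bit [measurable]:
  assumes "i < n"
  shows "(\<lambda>uw. fst uw i) \<in> U_measure n \<Otimes>\<^sub>M Wsp \<rightarrow>\<^sub>M count_space UNIV"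
  by (rule measurable_compose[OF measurable_fst]) (simp add: measurable_cong_sets[OF sets_U refl])

text \<open>Flipping coordinate \<open>i\<close> is an involution that exchanges the vectors with
  true and with false \<open>i\<close>-th bit.\<close>

lemma card_bits_half:
  assumes "i < n"
  shows "2 * card {u \<in> bits. u i} = card bits"
proof -
  have "bij_betw (\<lambda>u. u(i := \<not> u i)) {u \<in> bits. u i} {u \<in> bits. \<not> u i}"
    by (rule bij_betw_byWitness[where f'="\<lambda>u. u(i := \<not> u i)"])
      (use assms in \<open>auto simp: PiE_def extensional_def fun_eq_iff\<close>)
  then have "card {u \<in> bits. u i} = card {u \<in> bits. \<not> u i}" by (rule bij_betw_same_card)
  moreover have "card bits = card {u \<in> bits. u i} + card {u \<in> bits. \<not> u i}"
    using finite_bits by (subst card_Un_disjoint[symmetric]) (auto intro!: arg_cong[where f=card])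
  ultimately show ?thesis by simp
qed

text \<open>The hypothesis depends on the bits, but each \<open>A (select n zt u)\<close> has mass
  1, so the marginal law of the bits stays uniform.\<close>

lemma fair_bit_pair_cond_UW:
  assumes zt: "zt \<in> space SS" and i: "i < n"
  shows "fair_bit_pair (cond_UW n Wsp A zt) (DeltaL loss zt i) (\<lambda>uw. fst uw i)"
proof -
  let ?C = "cond_UW n Wsp A zt"
  interpret prob_space ?C by (rule prob_space_cond_UW[OF zt])
  note cong = measurable_cong_sets[OF sets_cond_UW[OF zt] refl]
  let ?Q = "{uw \<in> space ?C. fst uw i}"
  have Q: "?Q \<in> sets (U_measure n \<Otimes>\<^sub>M Wsp)"
    using measurable_sets[OF measurable_bit[OF i], of "{True}"]
    by (auto simp: space_cond_UW[OF zt] space_pair_measure space_U vimage_def Int_def conj_commute)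
  have "prob ?Q = (\<integral>uw. indicator ?Q uw \<partial>?C)"
    using Q by (simp add: sets_cond_UW[OF zt])
  also have "\<dots> = (\<Sum>u\<in>bits. \<integral>w. indicator ?Q (u, w) \<partial>A (select n zt u)) / card bits"
    using Q by (intro integral_cond_UW[OF zt, where B=1]) auto
  also have "(\<Sum>u\<in>bits. \<integral>w. indicator ?Q (u, w) \<partial>A (select n zt u))
      = (\<Sum>u\<in>bits. if u i then 1 else 0 :: real)"
  proof (intro sum.cong refl)
    fix u assume u: "u \<in> bits"
    interpret A: prob_space "A (select n zt u)" by (rule prob_space_A[OF select_space[OF zt]])
    have "(\<integral>w. indicator ?Q (u, w) \<partial>A (select n zt u))
        = (\<integral>w. (if u i then 1 else 0 :: real) \<partial>A (select n zt u))"
      using u by (intro Bochner_Integration.integral_cong)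
        (auto simp: space_A[OF select_space[OF zt]] space_cond_UW[OF zt])
    then show "(\<integral>w. indicator ?Q (u, w) \<partial>A (select n zt u)) = (if u i then 1 else 0 :: real)"
      using A.prob_space by (cases "u i") auto
  qed
  also have "\<dots> = real (card {u \<in> bits. u i})"
    using finite_bits by (simp add: sum.If_cases Int_def)
  also have "\<dots> / card bits = 1 / 2"
  proof -
    have "real c / real N = 1 / 2" if "2 * c = N" "N \<noteq> 0" for c N :: nat
      using that by auto
    from this[OF card_bits_half[OF i]] show ?thesis
      using finite_bits bits_nonempty by (simp only: card_eq_0_iff) blast
  qed
  finally have "prob ?Q = 1 / 2" .
  then show ?thesis
    using zt i by unfold_locales (simp_all add: cong)
qed

lemma disint_MI_eq:
  assumes "zt \<in> space SS" "i < n"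
  shows "disint_MI n Wsp A loss i zt
    = fair_bit_pair.mi (cond_UW n Wsp A zt) (DeltaL loss zt i) (\<lambda>uw. fst uw i)"
  by (simp add: disint_MI_def fair_bit_pair.mi_def[OF fair_bit_pair_cond_UW[OF assms]])

lemma disint_MI_bounds:
  assumes "zt \<in> space SS" "i < n"
  shows "0 \<le> disint_MI n Wsp A loss i zt" "disint_MI n Wsp A loss i zt \<le> ln 2"
  unfolding disint_MI_eq[OF assms]
  using fair_bit_pair.mi_nonneg[OF fair_bit_pair_cond_UW[OF assms]]
    fair_bit_pair.mi_le_ln_2[OF fair_bit_pair_cond_UW[OF assms]] by auto

section \<open>Measurability of the disintegrated information\<close>

lemma integral_cond_UW_DeltaL:
  fixes G :: "real \<times> bool \<Rightarrow> real"
  assumes zt: "zt \<in> space SS" and i: "i < n"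
    and [measurable]: "G \<in> borel_measurable (borel \<Otimes>\<^sub>M count_space UNIV)" and B: "\<And>z. \<bar>G z\<bar> \<le> B"
  shows "(\<integral>uw. G (DeltaL loss zt i uw, fst uw i) \<partial>cond_UW n Wsp A zt)
    = (\<Sum>u\<in>bits. \<integral>w. G (loss w (zt (i, True)) - loss w (zt (i, False)), u i)
        \<partial>A (select n zt u)) / card bits"
  using zt i B by (subst integral_cond_UW[OF zt, where B=B]) (auto simp: DeltaL_def)

lemma measurable_integral_cond_UW:
  fixes G :: "real \<times> bool \<Rightarrow> real"
  assumes i [measurable]: "i < n"
    and G [measurable]: "G \<in> borel_measurable (borel \<Otimes>\<^sub>M count_space UNIV)" and B: "\<And>z. \<bar>G z\<bar> \<le> B"
  shows "(\<lambda>zt. \<integral>uw. G (DeltaL loss zt i uw, fst uw i) \<partial>cond_UW n Wsp A zt) \<in> borel_measurable SS"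
proof (subst measurable_cong[OF integral_cond_UW_DeltaL[OF _ i G B]])
  have "(\<lambda>zt. \<integral>w. G (loss w (zt (i, True)) - loss w (zt (i, False)), u i) \<partial>A (select n zt u))
      \<in> borel_measurable SS" for u
    using borel_measurable_integral_kernel[of
        "\<lambda>(zt, w). G (loss w (zt (i, True)) - loss w (zt (i, False)), u i)" SS Wsp "\<lambda>zt. A (select n zt u)"]
    by simp
  then show "(\<lambda>zt. (\<Sum>u\<in>bits. \<integral>w. G (loss w (zt (i, True)) - loss w (zt (i, False)), u i)
        \<partial>A (select n zt u)) / card bits) \<in> borel_measurable SS"
    by simp
qed

text \<open>By \<open>mi_eq_SUP\<close> this is a countable supremum of dual values, each built from
  two integrals against the conditional law; no choice of densities enters.\<close>

lemma measurable_disint_MI [measurable]: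
  assumes i: "i < n"
  shows "disint_MI n Wsp A loss i \<in> borel_measurable SS"
proof -
  define V where "V c zt = fair_bit_pair.dual_value (cond_UW n Wsp A zt) (DeltaL loss zt i)
    (\<lambda>uw. fst uw i) (test_fun c)" for c zt
  \<comment> \<open>The dual value unfolded. Its second integrand is written as a function of the
    pair that ignores the bit, so that \<open>measurable_integral_cond_UW\<close> applies to both
    terms.\<close>
  let ?V = "\<lambda>c zt. (\<integral>uw. test_fun c (DeltaL loss zt i uw, fst uw i) \<partial>cond_UW n Wsp A zt)
    - (\<integral>uw. (\<lambda>(x, b). (exp (test_fun c (x, True)) + exp (test_fun c (x, False))) / 2)
        (DeltaL loss zt i uw, fst uw i) \<partial>cond_UW n Wsp A zt) + 1"
  have V: "V c zt = ?V c zt" if "zt \<in> space SS" for c zt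
    by (simp add: V_def fair_bit_pair.dual_value_def[OF fair_bit_pair_cond_UW[OF that i]])
  have meas: "V c \<in> borel_measurable SS" for c
  proof -
    obtain B where B: "\<And>z. \<bar>test_fun c z\<bar> \<le> B" using test_fun_bounded by blast
    have "\<bar>(exp (test_fun c (x, True)) + exp (test_fun c (x, False))) / 2\<bar> \<le> exp B" for x
    proof -
      have "exp (test_fun c (x, b)) \<le> exp B" for b
        using B[of "(x, b)"] by simp
      moreover have "\<bar>(a + b) / 2\<bar> \<le> d" if "0 < a" "0 < b" "a \<le> d" "b \<le> d" for a b d :: real
        using that by (simp add: abs_of_pos add_pos_pos)
      ultimately show ?thesis using exp_gt_zero by blast
    qed
    then have "?V c \<in> borel_measurable SS"
      using B by (intro borel_measurable_add borel_measurable_diff measurable_integral_cond_UW[OF i])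
        (auto split: prod.splits)
    then show ?thesis by (rule measurable_cong[THEN iffD2, rotated]) (rule V)
  qed
  have "(\<lambda>zt. SUP c. V c zt) \<in> borel_measurable SS"
  proof (rule borel_measurable_cSUP)
    fix zt assume zt: "zt \<in> space SS"
    interpret fair_bit_pair "cond_UW n Wsp A zt" "DeltaL loss zt i" "\<lambda>uw. fst uw i"
      by (rule fair_bit_pair_cond_UW[OF zt i])
    show "bdd_above (range (\<lambda>c. V c zt))"
      unfolding V_def using dual_value_le_mi[OF measurable_test_fun] test_fun_bounded
      by (intro bdd_aboveI[of _ mi]) blast
  qed (simp_all add: meas)
  then show ?thesis
    by (rule measurable_cong[THEN iffD2, rotated])
      (simp add: V_def disint_MI_eq[OF _ i] fair_bit_pair.mi_eq_SUP[OF fair_bit_pair_cond_UW[OF _ i]])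
qed

section \<open>From the supersample back to a sample and a ghost point\<close>

text \<open>Integrated over \<open>z\<close>, this is the $i$-th summand of the generalization error given $S = s$.\<close>

definition gap :: "nat \<Rightarrow> (nat \<Rightarrow> 'z) \<Rightarrow> 'z \<Rightarrow> real" where
  "gap i s z = (\<integral>w. loss w z - loss w (s i) \<partial>A s)"

lemma measurable_gap [measurable (raw)]:
  assumes i [measurable]: "i < n" and f [measurable]: "f \<in> M \<rightarrow>\<^sub>M S" and g [measurable]: "g \<in> M \<rightarrow>\<^sub>M \<mu>"
  shows "(\<lambda>x. gap i (f x) (g x)) \<in> borel_measurable M"
  unfolding gap_def
  using borel_measurable_integral_kernel[of "\<lambda>(x, w). loss w (g x) - loss w (f x i)" M Wsp "\<lambda>x. A (f x)"]
  by simp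

lemma gap_abs:
  assumes s: "s \<in> space S" and z: "z \<in> space \<mu>" and i: "i < n"
  shows "\<bar>gap i s z\<bar> \<le> 1"
proof -
  interpret A: prob_space "A s" by (rule prob_space_A[OF s])
  have int: "integrable (A s) (\<lambda>w. loss w z - loss w (s i))"
    using s z i S_component_space[OF s i]
    by (intro integrable_A[OF s, where B=1] loss_diff_abs) measurable
  have "\<bar>gap i s z\<bar> \<le> (\<integral>w. \<bar>loss w z - loss w (s i)\<bar> \<partial>A s)"
    unfolding gap_def by (rule integral_abs_bound)
  also have "\<dots> \<le> (\<integral>w. 1 \<partial>A s)"
    using int s z i by (intro integral_mono) (auto intro!: loss_diff_abs S_component_space simp: space_A)
  finally show ?thesis using A.prob_space by simp
qed

text \<open>The sign orients \<open>DeltaL\<close> as ghost loss minus training loss: for either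
  value of \<open>u i\<close>, the entry \<open>(i, u i)\<close> is the training point and
  \<open>(i, \<not> u i)\<close> the ghost point.\<close>

lemma cond_signed_eq:
  assumes zt: "zt \<in> space SS" and i: "i < n"
  shows "(\<integral>uw. (if fst uw i then - 1 else 1) * DeltaL loss zt i uw \<partial>cond_UW n Wsp A zt)
    = (\<Sum>u\<in>bits. gap i (select n zt u) (zt (i, \<not> u i))) / card bits"
proof (subst integral_cond_UW[OF zt, where B=1])
  show "(\<lambda>uw. (if fst uw i then - 1 else 1) * DeltaL loss zt i uw) \<in> borel_measurable (U_measure n \<Otimes>\<^sub>M Wsp)"
    using zt i by measurable
  show "\<bar>(if fst (u, w) i then - 1 else 1) * DeltaL loss zt i (u, w)\<bar> \<le> 1"
    if "u \<in> bits" "w \<in> space Wsp" for u w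
    using that SS_component_space[OF zt i] by (auto simp: DeltaL_def abs_mult intro!: loss_diff_abs)
  show "(\<Sum>u\<in>bits. \<integral>w. (if fst (u, w) i then - 1 else 1) * DeltaL loss zt i (u, w) \<partial>A (select n zt u)) / card bits
      = (\<Sum>u\<in>bits. gap i (select n zt u) (zt (i, \<not> u i))) / card bits"
    unfolding gap_def
    by (intro arg_cong2[where f="(/)"] sum.cong refl Bochner_Integration.integral_cong)
      (use i in \<open>auto simp: DeltaL_def select_def\<close>)
qed

text \<open>For fixed \<open>u\<close> the integrand reads \<open>n + 1\<close> distinct entries of
  the supersample. They are independent with law \<open>\<mu>\<close> whatever \<open>u\<close> is,
  so the value does not depend on \<open>u\<close>.\<close>

lemma integral_reindex:
  assumes i: "i < n"
  shows "(\<integral>zt. gap i (select n zt u) (zt (i, \<not> u i)) \<partial>SS) = (\<integral>s. (\<integral>z. gap i s z \<partial>\<mu>) \<partial>S)"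
proof -
  interpret product_prob_space "\<lambda>_::nat. \<mu>" UNIV by unfold_locales
  let ?P = "PiM {..<Suc n} (\<lambda>_. \<mu>)"
  \<comment> \<open>Index \<open>n\<close> is the slot of the ghost point. The map is injective
    since \<open>(i, u i)\<close> and \<open>(i, \<not> u i)\<close> differ, and projecting a
    product measure along an injective index map gives a product measure.\<close>
  let ?f = "\<lambda>k. if k < n then (k, u k) else (i, \<not> u i)"
  let ?r = "\<lambda>zt. \<lambda>k\<in>{..<Suc n}. zt (?f k)"
  let ?H = "\<lambda>x. gap i (restrict x {..<n}) (x n)"
  interpret PS: prob_space ?P by (intro prob_space_PiM mu)
  have f: "?f \<in> {..<Suc n} \<rightarrow> {..<n} \<times> UNIV" using i by auto
  have inj: "inj_on ?f {..<Suc n}" by (auto simp: inj_on_def less_Suc_eq split: if_splits)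
  have distr: "distr SS ?P ?r = ?P"
    unfolding supersample_space_def
    using distr_PiM_reindex[OF _ inj f, of "\<lambda>_. \<mu>"] mu by simp
  have r [measurable]: "?r \<in> SS \<rightarrow>\<^sub>M ?P"
    unfolding supersample_space_def by (intro measurable_restrict measurable_component_singleton funcset_mem[OF f])
  have [measurable]: "(\<lambda>x. restrict x {..<n}) \<in> ?P \<rightarrow>\<^sub>M S"
    unfolding sample_space_def by (intro measurable_restrict_subset) auto
  have H [measurable]: "?H \<in> borel_measurable ?P"
    using i by (intro measurable_gap) auto
  have "(\<integral>zt. gap i (select n zt u) (zt (i, \<not> u i)) \<partial>SS) = (\<integral>zt. ?H (?r zt) \<partial>SS)"
    by (intro Bochner_Integration.integral_cong refl arg_cong2[where f="gap i"])
      (auto simp: select_def fun_eq_iff)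
  also have "\<dots> = (\<integral>x. ?H x \<partial>distr SS ?P ?r)"
    by (rule integral_distr[OF r H, symmetric])
  \<comment> \<open>Splitting off the coordinate \<open>n\<close> separates the ghost point from the
    sample.\<close>
  also have "\<dots> = (\<integral>x. ?H x \<partial>PiM (insert n {..<n}) (\<lambda>_. \<mu>))"
    unfolding distr by (simp add: lessThan_Suc)
  also have "\<dots> = (\<integral>x. (\<integral>y. ?H (x(n := y)) \<partial>\<mu>) \<partial>PiM {..<n} (\<lambda>_. \<mu>))"
  proof (rule product_integral_insert)
    have "integrable ?P ?H"
    proof (rule PS.integrable_const_bound[where B=1])
      show "AE x in ?P. norm (?H x) \<le> 1"
        using i by (intro AE_I2) (auto simp: space_PiM sample_space_def PiE_def Pi_iff intro!: gap_abs)
    qed measurable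
    then show "integrable (PiM (insert n {..<n}) (\<lambda>_. \<mu>)) ?H" by (simp add: lessThan_Suc)
  qed auto
  also have "\<dots> = (\<integral>s. (\<integral>z. gap i s z \<partial>\<mu>) \<partial>S)"
    unfolding sample_space_def
    by (intro Bochner_Integration.integral_cong refl arg_cong2[where f="gap i"])
      (auto simp: space_PiM PiE_def extensional_def fun_eq_iff)
  finally show ?thesis .
qed

lemma integral_joint_SW:
  fixes f :: "(nat \<Rightarrow> 'z) \<times> 'w \<Rightarrow> real"
  assumes f [measurable]: "f \<in> borel_measurable (S \<Otimes>\<^sub>M Wsp)"
    and B: "\<And>s w. s \<in> space S \<Longrightarrow> w \<in> space Wsp \<Longrightarrow> \<bar>f (s, w)\<bar> \<le> B"
  shows "(\<integral>sw. f sw \<partial>joint_SW n \<mu> Wsp A) = (\<integral>s. (\<integral>w. f (s, w) \<partial>A s) \<partial>S)"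
proof -
  have K [measurable]: "(\<lambda>s. distr (A s) (S \<Otimes>\<^sub>M Wsp) (\<lambda>w. (s, w))) \<in> S \<rightarrow>\<^sub>M subprob_algebra (S \<Otimes>\<^sub>M Wsp)"
    by (rule measurable_distr2[where M=Wsp]) (simp_all add: split_beta')
  have "(\<integral>sw. f sw \<partial>joint_SW n \<mu> Wsp A)
      = (\<integral>s. (\<integral>sw. f sw \<partial>distr (A s) (S \<Otimes>\<^sub>M Wsp) (\<lambda>w. (s, w))) \<partial>S)"
    unfolding joint_SW_def
  proof (rule integral_bind[OF f _ K, where B=B and B'=1])
    show "\<bar>f x\<bar> \<le> B" if "x \<in> space (S \<Otimes>\<^sub>M Wsp)" for x
      using that B by (auto simp: space_pair_measure)
    show "finite_measure S" by (rule S.finite_measure_axioms)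
    show "AE s in S. emeasure (distr (A s) (S \<Otimes>\<^sub>M Wsp) (\<lambda>w. (s, w)))
        (space (distr (A s) (S \<Otimes>\<^sub>M Wsp) (\<lambda>w. (s, w)))) \<le> ennreal 1"
      using subprob_space.emeasure_space_le_1[OF subprob_space_kernel[OF K]] by (intro AE_I2) simp
  qed
  also have "\<dots> = (\<integral>s. (\<integral>w. f (s, w) \<partial>A s) \<partial>S)"
    by (intro Bochner_Integration.integral_cong refl integral_distr f measurable_Pair_A)
  finally show ?thesis .
qed

text \<open>Fubini exchanges ghost point and hypothesis, which are independent given the sample; the
  training term does not involve \<open>z\<close>, and \<open>\<mu>\<close> has mass 1.\<close>

lemma mean_gap:
  assumes s: "s \<in> space S" and i: "i < n"
  shows "(\<integral>z. gap i s z \<partial>\<mu>) = (\<integral>w. (\<integral>z. loss w z \<partial>\<mu>) \<partial>A s) - (\<integral>w. loss w (s i) \<partial>A s)"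
proof -
  interpret A: prob_space "A s" by (rule prob_space_A[OF s])
  interpret pair_prob_space "A s" \<mu> ..
  note [measurable_cong] = sets_A[OF s]
  have si [measurable]: "s i \<in> space \<mu>" by (rule S_component_space[OF s i])
  have int: "integrable (A s) (\<lambda>w. loss w z)" if "z \<in> space \<mu>" for z
    using that by (intro integrable_A[OF s, where B=1] loss_abs) measurable
  have int2: "integrable (A s \<Otimes>\<^sub>M \<mu>) (\<lambda>(w, z). loss w z)"
  proof (rule integrable_const_bound[where B=1])
    show "AE x in A s \<Otimes>\<^sub>M \<mu>. norm (case x of (w, z) \<Rightarrow> loss w z) \<le> 1"
      by (intro AE_I2) (auto simp: space_pair_measure space_A[OF s] intro: loss_abs)
    show "(\<lambda>(w, z). loss w z) \<in> borel_measurable (A s \<Otimes>\<^sub>M \<mu>)"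
      by (subst measurable_cong_sets[OF sets_pair_measure_cong[OF sets_A[OF s] refl] refl]) (rule loss_meas)
  qed
  have "(\<integral>z. gap i s z \<partial>\<mu>) = (\<integral>z. (\<integral>w. loss w z \<partial>A s) - (\<integral>w. loss w (s i) \<partial>A s) \<partial>\<mu>)"
    unfolding gap_def using int si by (intro Bochner_Integration.integral_cong) auto
  also have "\<dots> = (\<integral>z. (\<integral>w. loss w z \<partial>A s) \<partial>\<mu>) - (\<integral>w. loss w (s i) \<partial>A s)"
    using integrable_snd[OF int2] by (subst Bochner_Integration.integral_diff) (auto simp: mu.prob_space)
  also have "(\<integral>z. (\<integral>w. loss w z \<partial>A s) \<partial>\<mu>) = (\<integral>w. (\<integral>z. loss w z \<partial>\<mu>) \<partial>A s)"
    by (rule Fubini_integral[OF int2])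
  finally show ?thesis .
qed

text \<open>The population risk does not depend on \<open>i\<close>, so it may be counted once in
  each of the \<open>n\<close> summands. Given the sample, \<open>p\<close> is the expected
  population loss and \<open>q i\<close> the expected loss at the \<open>i\<close>-th training
  point.\<close>

lemma gen_err_eq: "gen_err n \<mu> Wsp A loss = (1 / real n) * (\<Sum>i<n. \<integral>s. (\<integral>z. gap i s z \<partial>\<mu>) \<partial>S)"
proof -
  define p where "p s = (\<integral>w. (\<integral>z. loss w z \<partial>\<mu>) \<partial>A s)" for s
  define q where "q i s = (\<integral>w. loss w (s i) \<partial>A s)" for i s
  have mean_abs: "\<bar>\<integral>z. loss w z \<partial>\<mu>\<bar> \<le> 1" if w [measurable]: "w \<in> space Wsp" for w
  proof -
    have "integrable \<mu> (\<lambda>z. loss w z)"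
      by (intro mu.integrable_const_bound[where B=1] AE_I2) (auto intro: loss_abs w)
    then have "(\<integral>z. \<bar>loss w z\<bar> \<partial>\<mu>) \<le> (\<integral>z. 1 \<partial>\<mu>)"
      using w by (intro integral_mono) (auto intro: loss_abs)
    then show ?thesis
      using order_trans[OF integral_abs_bound] by (simp add: mu.prob_space)
  qed
  have [measurable]: "(\<lambda>w. \<integral>z. loss w z \<partial>\<mu>) \<in> borel_measurable Wsp"
    by measurable
  have pop: "pop_risk n \<mu> Wsp A loss = (\<integral>s. p s \<partial>S)"
    unfolding pop_risk_def p_def
    by (subst integral_joint_SW[where B=1]) (auto intro: mean_abs)
  have q_meas [measurable]: "q i \<in> borel_measurable S" if [measurable]: "i < n" for i
    unfolding q_def[abs_def]
    using borel_measurable_integral_kernel[of "\<lambda>(s, w). loss w (s i)" S Wsp A] by simp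
  have p_meas [measurable]: "p \<in> borel_measurable S"
    unfolding p_def[abs_def]
    using borel_measurable_integral_kernel[of "\<lambda>(s, w). \<integral>z. loss w z \<partial>\<mu>" S Wsp A] by simp
  have abs_A: "\<bar>\<integral>w. f w \<partial>A s\<bar> \<le> 1"
    if s: "s \<in> space S" and f: "f \<in> borel_measurable Wsp" "\<And>w. w \<in> space Wsp \<Longrightarrow> \<bar>f w\<bar> \<le> 1"
    for s and f :: "'w \<Rightarrow> real"
  proof -
    interpret A: prob_space "A s" by (rule prob_space_A[OF s])
    have "(\<integral>w. \<bar>f w\<bar> \<partial>A s) \<le> (\<integral>w. 1 \<partial>A s)"
      using integrable_A[OF s f] f s by (intro integral_mono) (auto simp: space_A)
    then show ?thesis using order_trans[OF integral_abs_bound] A.prob_space by simp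
  qed
  have p_int: "integrable S p"
    by (rule S.integrable_const_bound[where B=1]) (auto simp: p_def intro!: abs_A mean_abs)
  have q_int: "integrable S (q i)" if i [measurable]: "i < n" for i
  proof (rule S.integrable_const_bound[where B=1])
    show "AE s in S. norm (q i s) \<le> 1"
    proof (rule AE_I2)
      fix s assume s: "s \<in> space S"
      have [measurable]: "s i \<in> space \<mu>" by (rule S_component_space[OF s i])
      show "norm (q i s) \<le> 1"
        unfolding q_def real_norm_def by (rule abs_A[OF s]) (auto intro!: loss_abs S_component_space[OF s i])
    qed
  qed measurable
  have "emp_risk n \<mu> Wsp A loss = (\<integral>s. (\<integral>w. (1 / real n) * (\<Sum>i<n. loss w (s i)) \<partial>A s) \<partial>S)"
    unfolding emp_risk_def
  proof (subst integral_joint_SW[where B=1])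
    show "(\<lambda>sw. (1 / real n) * (\<Sum>i<n. loss (snd sw) (fst sw i))) \<in> borel_measurable (S \<Otimes>\<^sub>M Wsp)"
      by measurable
    fix s w assume "s \<in> space S" "w \<in> space Wsp"
    then have "\<bar>\<Sum>i<n. loss w (s i)\<bar> \<le> (\<Sum>i<n. 1)"
      by (intro order_trans[OF sum_abs] sum_mono loss_abs S_component_space) auto
    then show "\<bar>(1 / real n) * (\<Sum>i<n. loss (snd (s, w)) (fst (s, w) i))\<bar> \<le> 1"
      using n_pos by (simp add: abs_mult field_simps)
  qed simp
  also have "\<dots> = (\<integral>s. (1 / real n) * (\<Sum>i<n. q i s) \<partial>S)"
  proof (intro Bochner_Integration.integral_cong refl)
    fix s assume s: "s \<in> space S"
    have "integrable (A s) (\<lambda>w. loss w (s i))" if "i < n" for i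
      using S_component_space[OF s that] by (intro integrable_A[OF s, where B=1] loss_abs) auto
    then show "(\<integral>w. (1 / real n) * (\<Sum>i<n. loss w (s i)) \<partial>A s) = (1 / real n) * (\<Sum>i<n. q i s)"
      unfolding q_def by (subst integral_mult_right_zero, subst Bochner_Integration.integral_sum) auto
  qed
  also have "\<dots> = (1 / real n) * (\<Sum>i<n. \<integral>s. q i s \<partial>S)"
    using q_int by (subst integral_mult_right_zero, subst Bochner_Integration.integral_sum) auto
  finally have emp: "emp_risk n \<mu> Wsp A loss = (1 / real n) * (\<Sum>i<n. \<integral>s. q i s \<partial>S)" .
  have gap: "(\<integral>s. (\<integral>z. gap i s z \<partial>\<mu>) \<partial>S) = (\<integral>s. p s \<partial>S) - (\<integral>s. q i s \<partial>S)" if i: "i < n" for i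
  proof -
    have "(\<integral>s. (\<integral>z. gap i s z \<partial>\<mu>) \<partial>S) = (\<integral>s. p s - q i s \<partial>S)"
      using mean_gap[OF _ i] by (intro Bochner_Integration.integral_cong) (auto simp: p_def q_def)
    then show ?thesis using p_int q_int[OF i] by simp
  qed
  have "(\<Sum>i<n. \<integral>s. (\<integral>z. gap i s z \<partial>\<mu>) \<partial>S) = real n * (\<integral>s. p s \<partial>S) - (\<Sum>i<n. \<integral>s. q i s \<partial>S)"
    by (simp add: gap sum_subtractf)
  then show ?thesis
    using n_pos unfolding gen_err_def pop emp by (simp add: field_simps)
qed

text \<open>The average over the bits is finite and commutes with the integral over the supersample;
  by \<open>integral_reindex\<close> all bit vectors contribute the same value.\<close>

lemma gen_err_eq_supersample:
  "gen_err n \<mu> Wsp A loss = (1 / real n) * (\<Sum>i<n. \<integral>zt.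
    (\<integral>uw. (if fst uw i then - 1 else 1) * DeltaL loss zt i uw \<partial>cond_UW n Wsp A zt) \<partial>SS)"
proof -
  have "(\<integral>zt. (\<integral>uw. (if fst uw i then - 1 else 1) * DeltaL loss zt i uw \<partial>cond_UW n Wsp A zt) \<partial>SS)
      = (\<integral>s. (\<integral>z. gap i s z \<partial>\<mu>) \<partial>S)" if i [measurable]: "i < n" for i
  proof -
    have int: "integrable SS (\<lambda>zt. gap i (select n zt u) (zt (i, \<not> u i)))" for u
      using i by (intro SS.integrable_const_bound[where B=1] AE_I2)
        (auto intro!: gap_abs select_space SS_component_space measurable_gap)
    have "(\<integral>zt. (\<integral>uw. (if fst uw i then - 1 else 1) * DeltaL loss zt i uw \<partial>cond_UW n Wsp A zt) \<partial>SS)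
        = (\<integral>zt. (\<Sum>u\<in>bits. gap i (select n zt u) (zt (i, \<not> u i))) / card bits \<partial>SS)"
      by (intro Bochner_Integration.integral_cong refl cond_signed_eq i)
    also have "\<dots> = (\<Sum>u\<in>bits. \<integral>zt. gap i (select n zt u) (zt (i, \<not> u i)) \<partial>SS) / card bits"
      using int by (subst integral_divide_zero, subst Bochner_Integration.integral_sum) auto
    also have "\<dots> = (\<integral>s. (\<integral>z. gap i s z \<partial>\<mu>) \<partial>S)"
      using finite_bits bits_nonempty by (simp add: integral_reindex[OF i])
    finally show ?thesis .
  qed
  then show ?thesis by (simp add: gen_err_eq)
qed

section \<open>The two inequalities\<close>

lemma DeltaL_abs:
  assumes zt: "zt \<in> space SS" and i: "i < n" and uw: "uw \<in> space (cond_UW n Wsp A zt)"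
  shows "\<bar>DeltaL loss zt i uw\<bar> \<le> 1"
proof -
  have "snd uw \<in> space Wsp"
    using uw by (simp add: space_cond_UW[OF zt] mem_Times_iff)
  then show ?thesis
    unfolding DeltaL_def
    by (rule loss_diff_abs[OF _ SS_component_space[OF zt i] SS_component_space[OF zt i]])
qed

lemma abs_cond_signed_le:
  assumes zt: "zt \<in> space SS" and i: "i < n"
  shows "\<bar>\<integral>uw. (if fst uw i then - 1 else 1) * DeltaL loss zt i uw \<partial>cond_UW n Wsp A zt\<bar>
    \<le> sqrt (2 * disint_MI n Wsp A loss i zt)"
  unfolding disint_MI_eq[OF assms]
  using fair_bit_pair.signed_expectation_le[OF fair_bit_pair_cond_UW[OF assms] DeltaL_abs[OF assms]]
  by simp

lemma abs_gen_err_le: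
  "\<bar>gen_err n \<mu> Wsp A loss\<bar>
    \<le> (1 / real n) * (\<Sum>i<n. \<integral>zt. sqrt (2 * disint_MI n Wsp A loss i zt) \<partial>SS)"
proof -
  let ?E = "\<lambda>i zt. \<integral>uw. (if fst uw i then - 1 else 1) * DeltaL loss zt i uw \<partial>cond_UW n Wsp A zt"
  have *: "\<bar>\<integral>zt. ?E i zt \<partial>SS\<bar> \<le> (\<integral>zt. sqrt (2 * disint_MI n Wsp A loss i zt) \<partial>SS)" if i: "i < n" for i
  proof -
    \<comment> \<open>The constant is the uniform bound \<open>ln 2\<close> on the information, put
      under the root.\<close>
    have int: "integrable SS (\<lambda>zt. sqrt (2 * disint_MI n Wsp A loss i zt))"
      using disint_MI_bounds[OF _ i] measurable_disint_MI[OF i]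
      by (intro SS.integrable_const_bound[where B="sqrt (2 * ln 2)"] AE_I2) auto
    have "\<bar>\<integral>zt. ?E i zt \<partial>SS\<bar> \<le> (\<integral>zt. \<bar>?E i zt\<bar> \<partial>SS)" by (rule integral_abs_bound)
    also have "\<dots> \<le> (\<integral>zt. sqrt (2 * disint_MI n Wsp A loss i zt) \<partial>SS)"
      using abs_cond_signed_le[OF _ i] int disint_MI_bounds(1)[OF _ i]
      by (intro integral_mono') auto
    finally show ?thesis .
  qed
  have "\<bar>gen_err n \<mu> Wsp A loss\<bar> = (1 / real n) * \<bar>\<Sum>i<n. \<integral>zt. ?E i zt \<partial>SS\<bar>"
    by (simp add: gen_err_eq_supersample abs_mult)
  also have "\<dots> \<le> (1 / real n) * (\<Sum>i<n. \<integral>zt. sqrt (2 * disint_MI n Wsp A loss i zt) \<partial>SS)"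
    using * by (intro mult_left_mono order_trans[OF sum_abs] sum_mono) auto
  finally show ?thesis .
qed

text \<open>Jensen over the supersample. The integrand of \<open>cond_MI\<close> is measurable and
  bounded, so \<open>cond_MI\<close> is a genuine expectation and not the default value 0.\<close>

lemma expectation_sqrt_disint_MI_le:
  assumes i: "i < n"
  shows "(\<integral>zt. sqrt (2 * disint_MI n Wsp A loss i zt) \<partial>SS) \<le> sqrt (2 * cond_MI n \<mu> Wsp A loss i)"
proof -
  have "(\<integral>zt. sqrt (2 * disint_MI n Wsp A loss i zt) \<partial>SS)
      \<le> sqrt (\<integral>zt. 2 * disint_MI n Wsp A loss i zt \<partial>SS)"
    using disint_MI_bounds[OF _ i] measurable_disint_MI[OF i]
    by (intro SS.expectation_sqrt_le[where B="2 * ln 2"]) auto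
  then show ?thesis by (simp add: cond_MI_def)
qed

end

theorem theorem1:
  fixes n :: nat and \<mu> :: "'z measure" and Wsp :: "'w measure"
    and A :: "(nat \<Rightarrow> 'z) \<Rightarrow> 'w measure" and loss :: "'w \<Rightarrow> 'z \<Rightarrow> real"
  assumes n_pos: "n \<ge> 1"
    and mu: "prob_space \<mu>"
    and A_kernel: "A \<in> sample_space n \<mu> \<rightarrow>\<^sub>M prob_algebra Wsp"
    and loss_meas: "(\<lambda>(w, z). loss w z) \<in> borel_measurable (Wsp \<Otimes>\<^sub>M \<mu>)"
    and loss_bounded: "\<And>w z. w \<in> space Wsp \<Longrightarrow> z \<in> space \<mu> \<Longrightarrow> 0 \<le> loss w z \<and> loss w z \<le> 1"
  shows "\<bar>gen_err n \<mu> Wsp A loss\<bar>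
           \<le> (1 / real n) * (\<Sum>i<n. \<integral>zt. sqrt (2 * disint_MI n Wsp A loss i zt) \<partial>supersample_space n \<mu>)
         \<and> (1 / real n) * (\<Sum>i<n. \<integral>zt. sqrt (2 * disint_MI n Wsp A loss i zt) \<partial>supersample_space n \<mu>)
           \<le> (1 / real n) * (\<Sum>i<n. sqrt (2 * cond_MI n \<mu> Wsp A loss i))"
proof -
  interpret supersample_setting n \<mu> Wsp A loss by (rule supersample_setting.intro) fact+
  show ?thesis
    by (intro conjI abs_gen_err_le mult_left_mono sum_mono expectation_sqrt_disint_MI_le) auto
qed

end
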